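(* Let $\Gamma$ be a nontrivial finite group and let $n \ge 3$ be an integer. Let $\mathcal{M}_{n,\Gamma}$ be the class of lifts $M$ of the cycle matroid $M(K_n^{\Gamma})$ such that a cycle of $K_n^{\Gamma}$ is a circuit of $M$ if and only if it is balanced. Then $\mathcal{M}_{n,\Gamma}$ contains a non-elementary lift (i.e. a lift whose rank exceeds that of $M(K_n^\Gamma)$ by at least $2$) in precisely the following cases: (1) $n = 3$ and $\Gamma$ has a nontrivial partition; or (2) $n \ge 4$ and $\Gamma \cong \mathbb{Z}_p^j$ for some prime $p$ and integer $j \ge 2$.
   Context: For a finite group $\Gamma$ with identity $\epsilon$ and integer $n$, $K_n^{\Gamma}$ is the graph with vertex set $[n]=\{1,\dots,n\}$ and edge set $\binom{[n]}{2}\times\Gamma$; the edge $(\{i,j\},\alpha)$ with $i<j$ is oriented from $i$ to $j$ and labeled $\alpha$. A cycle (including a $2$-edge cycle formed by two parallel edges) is balanced if, traversing it in a cyclic order and multiplying the labels, using $\alpha$ for an edge traversed along its orientation and $\alpha^{-1}$ for an edge traversed against it, the product is $\epsilon$ (this does not depend on the starting point or direction). $M(K_n^\Gamma)$ is the cycle (graphic) matroid of $K_n^\Gamma$. Given matroids $M, L$ on a common ground set $E$, $L$ is a lift of $M$ if there is a matroid $K$ on $E\cup F$ with $M = K/F$ and $L = K\setminus F$. A nontrivial partition of $\Gamma$ is a partition of $\Gamma\setminus\{\epsilon\}$ into at least two sets $A_1,\dots,A_k$ such that each $A_i\cup\{\epsilon\}$ is a subgroup of $\Gamma$. $\mathbb{Z}_p^j$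 is the direct sum of $j$ copies of the cyclic group of order $p$. *)

theory Defs
  imports "HOL-Algebra.Product_Groups" "HOL-Library.Disjoint_Sets" "HOL-Computational_Algebra.Primes"
begin

record 'e indep_system =
  ground :: "'e set"
  indep :: "'e set set"

locale matroid =
  fixes M :: "'e indep_system"
  assumes finite_ground: "finite (ground M)"
    and indep_subset_ground: "X \<in> indep M \<Longrightarrow> X \<subseteq> ground M"
    and indep_empty: "{} \<in> indep M"
    and indep_subset: "X \<in> indep M \<Longrightarrow> Y \<subseteq> X \<Longrightarrow> Y \<in> indep M"
    and indep_augment: "X \<in> indep M \<Longrightarrow> Y \<in> indep M \<Longrightarrow> card X < card Y \<Longrightarrow>
      \<exists>e\<in>Y - X. insert e X \<in> indep M"

definition circuit :: "'e indep_system \<Rightarrow> 'e set \<Rightarrow> bool" where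
  "circuit M C \<longleftrightarrow> C \<subseteq> ground M \<and> C \<notin> indep M \<and> (\<forall>X. X \<subset> C \<longrightarrow> X \<in> indep M)"

definition matroid_rank :: "'e indep_system \<Rightarrow> nat" where
  "matroid_rank M = Max (card ` indep M)"

definition basis_of :: "'e indep_system \<Rightarrow> 'e set \<Rightarrow> 'e set \<Rightarrow> bool" where
  "basis_of M X B \<longleftrightarrow> B \<subseteq> X \<and> B \<in> indep M \<and>
     (\<forall>B'. B \<subseteq> B' \<and> B' \<subseteq> X \<and> B' \<in> indep M \<longrightarrow> B' = B)"

definition delete :: "'e indep_system \<Rightarrow> 'e set \<Rightarrow> 'e indep_system" where
  "delete M X = \<lparr>ground = ground M - X, indep = {Y \<in> indep M. Y \<subseteq> ground M - X}\<rparr>"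

definition contract :: "'e indep_system \<Rightarrow> 'e set \<Rightarrow> 'e indep_system" where
  "contract M X = \<lparr>ground = ground M - X,
     indep = {Y. Y \<subseteq> ground M - X \<and> (\<exists>B. basis_of M X B \<and> Y \<union> B \<in> indep M)}\<rparr>"

definition relabel :: "('e \<Rightarrow> 'f) \<Rightarrow> 'e indep_system \<Rightarrow> 'f indep_system" where
  "relabel f M = \<lparr>ground = f ` ground M, indep = (`) f ` indep M\<rparr>"

text \<open>
  The disjoint union of \<open>E\<close> and \<open>F\<close> is rendered in a sum type. Since \<open>F\<close> is finite,
  taking its elements to be natural numbers is no restriction.
\<close>

definition is_lift :: "'e indep_system \<Rightarrow> 'e indep_system \<Rightarrow> bool" where
  "is_lift L M \<longleftrightarrow> matroid L \<and> matroid M \<and> ground L = ground M \<and>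
     (\<exists>(K :: ('e + nat) indep_system) (F :: nat set).
        matroid K \<and> ground K = Inl ` ground M \<union> Inr ` F \<and>
        relabel Inl M = contract K (Inr ` F) \<and>
        relabel Inl L = delete K (Inr ` F))"

text \<open>
  Multigraphs are given by an edge set and the map sending an edge to its set of ends.
  Distinctness of \<open>es\<close> matters only for length 2, where it leaves exactly the pairs of
  parallel edges. A loop would be a traversal of length 1.
\<close>

definition cycle_traversal ::
    "'e set \<Rightarrow> ('e \<Rightarrow> 'v set) \<Rightarrow> 'v list \<Rightarrow> 'e list \<Rightarrow> bool" where
  "cycle_traversal E ends vs es \<longleftrightarrow>
     es \<noteq> [] \<and> length vs = length es \<and> distinct vs \<and> distinct es \<and> set es \<subseteq> E \<and>
     (\<forall>i<length es. ends (es ! i) = {vs ! i, vs ! (Suc i mod length es)})"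

definition graph_cycle :: "'e set \<Rightarrow> ('e \<Rightarrow> 'v set) \<Rightarrow> 'e set \<Rightarrow> bool" where
  "graph_cycle E ends C \<longleftrightarrow> (\<exists>vs es. cycle_traversal E ends vs es \<and> C = set es)"

definition cycle_matroid :: "'e set \<Rightarrow> ('e \<Rightarrow> 'v set) \<Rightarrow> 'e indep_system" where
  "cycle_matroid E ends =
     \<lparr>ground = E, indep = {X. X \<subseteq> E \<and> \<not> (\<exists>C. graph_cycle E ends C \<and> C \<subseteq> X)}\<rparr>"

definition gain_edges :: "nat \<Rightarrow> ('a, 'b) monoid_scheme \<Rightarrow> (nat set \<times> 'a) set" where
  "gain_edges n G = {e. e \<subseteq> {1..n} \<and> card e = 2} \<times> carrier G"

abbreviation gain_cycle :: "nat \<Rightarrow> ('a, 'b) monoid_scheme \<Rightarrow> (nat set \<times> 'a) set \<Rightarrow> bool" where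
  "gain_cycle n G \<equiv> graph_cycle (gain_edges n G) fst"

abbreviation gain_cycle_matroid ::
    "nat \<Rightarrow> ('a, 'b) monoid_scheme \<Rightarrow> (nat set \<times> 'a) indep_system" where
  "gain_cycle_matroid n G \<equiv> cycle_matroid (gain_edges n G) fst"

text \<open>
  Edges are oriented from the smaller to the larger end, so the label is inverted exactly
  when an edge is traversed towards its smaller end.
\<close>

definition traversal_gain ::
    "('a, 'b) monoid_scheme \<Rightarrow> nat list \<Rightarrow> (nat set \<times> 'a) list \<Rightarrow> 'a" where
  "traversal_gain G vs es =
     foldr (\<otimes>\<^bsub>G\<^esub>)
       (map (\<lambda>i. if vs ! i < vs ! (Suc i mod length es)
                 then snd (es ! i) else inv\<^bsub>G\<^esub> snd (es ! i)) [0..<length es])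
       \<one>\<^bsub>G\<^esub>"

text \<open>
  Whether the product is the identity depends neither on the starting point nor on the
  direction, so requiring it for one traversal is the same as requiring it for all of them.
\<close>

definition balanced :: "nat \<Rightarrow> ('a, 'b) monoid_scheme \<Rightarrow> (nat set \<times> 'a) set \<Rightarrow> bool" where
  "balanced n G C \<longleftrightarrow>
     (\<exists>vs es. cycle_traversal (gain_edges n G) fst vs es \<and> C = set es \<and>
        traversal_gain G vs es = \<one>\<^bsub>G\<^esub>)"

definition gain_lifts ::
    "nat \<Rightarrow> ('a, 'b) monoid_scheme \<Rightarrow> (nat set \<times> 'a) indep_system set" where
  "gain_lifts n G =
     {M. is_lift M (gain_cycle_matroid n G) \<and>
         (\<forall>C. gain_cycle n G C \<longrightarrow> (circuit M C \<longleftrightarrow> balanced n G C))}"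

definition nontrivial_group_partition :: "('a, 'b) monoid_scheme \<Rightarrow> 'a set set \<Rightarrow> bool" where
  "nontrivial_group_partition G P \<longleftrightarrow>
     partition_on (carrier G - {\<one>\<^bsub>G\<^esub>}) P \<and> card P \<ge> 2 \<and>
     (\<forall>A\<in>P. subgroup (A \<union> {\<one>\<^bsub>G\<^esub>}) G)"

end

theory Submission
  imports Defs "HOL-Algebra.Multiplicative_Group"
begin

text \<open>
  A matroid \<open>L\<close> is a lift of \<open>M\<close> if and only if the excess \<open>r\<^sub>L - r\<^sub>M\<close> is monotone: for a
  monotone excess of at most \<open>k\<close>, the matroid with rank function
  \<open>min (r\<^sub>L X + card S) (r\<^sub>M X + k)\<close> on the disjoint union of the ground set with \<open>k\<close> new elements
  witnesses the lift.

  Given a lift, contract the edges with label \<open>1\<close>. All edges with the same label become parallel,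
  and balanced triangles show that the labels that are parallel to a given one form a subgroup
  together with \<open>1\<close>; the rank condition says that there are at least two such classes. Four
  vertices allow two disjoint digons to be joined by an edge with an arbitrary label, which forces
  the classes to be invariant under conjugation, and a partition into normal subgroups only exists
  in an elementary abelian group.

  Conversely, given a partition into subgroups \<open>A\<close>, let a set of edges have excess 0 if
  it is balanced, excess at most 1 if after switching all its labels lie in one \<open>A\<close>, and
  excess 2 otherwise. This gives a lift if the partition is invariant under conjugation,
  which can be achieved by passing to the common refinement of all conjugates, and if in
  addition \<open>n = 3\<close> or all subgroups \<open>A\<close> are normal.
\<close>

section \<open>Rank functions of matroids\<close>

text \<open>A potential is not unique: a further switching replaces the subgroup \<open>A\<close> by
  a conjugate. This is why the excess asks for some potential and some subgroup of the family, and
  why the family is required to be closed under conjugation. The real obstacle is an edge that joins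
  two components. It already raises the graphic rank, so it must not raise the excess as well, and
  its label has to be absorbed by switching one side as a whole. This conjugates the labels on that
  side and may lead out of \<open>A\<close>. On three vertices one of the two sides is a vertex
  without edges, so nothing is conjugated; from four vertices on, both sides can carry an unbalanced
  digon, which is why normality suffices in one direction and is forced in the other. The 2 in the
  rank condition is the point where classes separate: a spanning tree labelled by the identity has
  excess 0, one more edge raises the rank to at most \<open>n\<close>, and if the class of its label
  were the whole group, these \<open>n\<close> edges would span the lift.\<close>

definition rk :: "'e indep_system \<Rightarrow> 'e set \<Rightarrow> nat" where
  "rk M X = Max (card ` {Y \<in> indep M. Y \<subseteq> X})"

text \<open>Elements outside the ground set never change a rank, so every closure contains all of
  them. Rank estimates through closures therefore cut back to the ground set, which also provides
  finiteness.\<close>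

definition clos :: "'e indep_system \<Rightarrow> 'e set \<Rightarrow> 'e set" where
  "clos M X = {e. rk M (insert e X) = rk M X}"

context matroid
begin

lemma finite_indep: "X \<in> indep M \<Longrightarrow> finite X"
  using finite_ground indep_subset_ground finite_subset by blast

lemma finite_indep_sets: "finite (indep M)"
  by (rule finite_subset[of _ "Pow (ground M)"]) (use finite_ground indep_subset_ground in auto)

lemma card_le_rk: "Y \<in> indep M \<Longrightarrow> Y \<subseteq> X \<Longrightarrow> card Y \<le> rk M X"
  unfolding rk_def by (rule Max_ge) (use finite_indep_sets in auto)

lemma rk_attained: "\<exists>B \<in> indep M. B \<subseteq> X \<and> card B = rk M X"
proof -
  have "rk M X \<in> card ` {Y \<in> indep M. Y \<subseteq> X}"
    unfolding rk_def by (rule Max_in) (use finite_indep_sets indep_empty in auto)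
  then show ?thesis by auto
qed

lemma rk_le_card: "finite X \<Longrightarrow> rk M X \<le> card X"
  using rk_attained[of X] card_mono by metis

lemma rk_indep: "X \<in> indep M \<Longrightarrow> rk M X = card X"
  using card_le_rk[of X X] rk_le_card[of X] finite_indep by fastforce

lemma indep_iff_rk: "finite X \<Longrightarrow> X \<in> indep M \<longleftrightarrow> rk M X = card X"
  using rk_attained[of X] rk_indep card_subset_eq by metis

lemma rk_empty [simp]: "rk M {} = 0"
  using rk_indep[OF indep_empty] by simp

lemma rk_mono: "X \<subseteq> Y \<Longrightarrow> rk M X \<le> rk M Y"
  using rk_attained[of X] card_le_rk by (metis subset_trans)

lemma extend_to_basis:
  assumes "I \<in> indep M" "I \<subseteq> X"
  shows "\<exists>B \<in> indep M. I \<subseteq> B \<and> B \<subseteq> X \<and> card B = rk M X"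
  using assms
proof (induction "rk M X - card I" arbitrary: I rule: less_induct)
  case less
  show ?case
  proof (cases "card I = rk M X")
    case False
    obtain B where B: "B \<in> indep M" "B \<subseteq> X" "card B = rk M X" using rk_attained by blast
    have lt: "card I < card B" using False card_le_rk[OF less.prems] B by simp
    then obtain e where e: "e \<in> B - I" "insert e I \<in> indep M"
      using indep_augment less.prems(1) B(1) by blast
    have "card (insert e I) = Suc (card I)" using e finite_indep less.prems by auto
    then have "rk M X - card (insert e I) < rk M X - card I" using lt B by simp
    moreover have "insert e I \<subseteq> X" using e B less.prems by auto
    ultimately obtain C where "C \<in> indep M" "insert e I \<subseteq> C" "C \<subseteq> X" "card C = rk M X"
      using less.hyps e(2) by blast
    then show ?thesis by blast
  qed (use less.prems in auto)
qed

lemma rk_submodular: "rk M (X \<union> Y) + rk M (X \<inter> Y) \<le> rk M X + rk M Y"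
proof -
  obtain I where I: "I \<in> indep M" "I \<subseteq> X \<inter> Y" "card I = rk M (X \<inter> Y)" using rk_attained by blast
  obtain B where B: "B \<in> indep M" "I \<subseteq> B" "B \<subseteq> X \<union> Y" "card B = rk M (X \<union> Y)"
    using extend_to_basis[of I "X \<union> Y"] I by blast
  have fin: "finite B" using B finite_indep by blast
  have "card B + card I \<le> card (B \<inter> X) + card (B \<inter> Y)"
  proof -
    have "card (B \<inter> X) + card (B \<inter> Y) = card ((B \<inter> X) \<union> (B \<inter> Y)) + card ((B \<inter> X) \<inter> (B \<inter> Y))"
      by (rule card_Un_Int) (use fin in auto)
    moreover have "(B \<inter> X) \<union> (B \<inter> Y) = B" using B by auto
    moreover have "card I \<le> card ((B \<inter> X) \<inter> (B \<inter> Y))"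
      by (rule card_mono) (use fin I B in auto)
    ultimately show ?thesis by simp
  qed
  moreover have "card (B \<inter> X) \<le> rk M X" "card (B \<inter> Y) \<le> rk M Y"
    using card_le_rk indep_subset[OF B(1)] by auto
  ultimately show ?thesis using B I by simp
qed

lemma rk_insert_le: "rk M (insert e X) \<le> Suc (rk M X)"
proof -
  have "rk M (X \<union> {e}) + rk M (X \<inter> {e}) \<le> rk M X + rk M {e}" by (rule rk_submodular)
  moreover have "rk M {e} \<le> 1" using rk_le_card[of "{e}"] by simp
  ultimately show ?thesis by simp
qed

lemma rk_insert_mono: "rk M X \<le> rk M (insert e X)"
  by (rule rk_mono) auto

lemma rk_outside_ground: "rk M X = rk M (X \<inter> ground M)"
proof (rule antisym)
  obtain B where "B \<in> indep M" "B \<subseteq> X" "card B = rk M X" using rk_attained by blast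
  then show "rk M X \<le> rk M (X \<inter> ground M)" using card_le_rk indep_subset_ground by (metis le_inf_iff)
qed (simp add: rk_mono)

lemma matroid_rank_eq_rk: "matroid_rank M = rk M (ground M)"
proof -
  have "{Y \<in> indep M. Y \<subseteq> ground M} = indep M" using indep_subset_ground by auto
  then show ?thesis by (simp add: rk_def matroid_rank_def)
qed

lemma clos_increasing: "X \<subseteq> clos M X"
  by (auto simp: clos_def insert_absorb)

lemma clos_mono: "X \<subseteq> Y \<Longrightarrow> clos M X \<subseteq> clos M Y"
proof
  fix e assume "X \<subseteq> Y" "e \<in> clos M X"
  then have e: "rk M (insert e X) = rk M X" by (simp add: clos_def)
  have "rk M (insert e X \<union> Y) + rk M (insert e X \<inter> Y) \<le> rk M (insert e X) + rk M Y"
    by (rule rk_submodular)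
  moreover have "rk M X \<le> rk M (insert e X \<inter> Y)" by (rule rk_mono) (use \<open>X \<subseteq> Y\<close> in auto)
  moreover have "insert e X \<union> Y = insert e Y" using \<open>X \<subseteq> Y\<close> by auto
  ultimately show "e \<in> clos M Y" using e rk_insert_mono[of Y e] by (simp add: clos_def)
qed

lemma rk_Un_clos:
  assumes "finite Z" "Z \<subseteq> clos M X"
  shows "rk M (X \<union> Z) = rk M X"
  using assms
proof (induction Z)
  case (insert e Z)
  have "e \<in> clos M (X \<union> Z)" using insert clos_mono[of X "X \<union> Z"] by auto
  then show ?case using insert by (simp add: clos_def)
qed simp

lemma rk_le_if_subset_clos:
  assumes "Z \<subseteq> clos M X"
  shows "rk M Z \<le> rk M X"
proof -
  have "rk M Z = rk M (Z \<inter> ground M)" by (rule rk_outside_ground)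
  also have "\<dots> \<le> rk M (X \<union> (Z \<inter> ground M))" by (rule rk_mono) auto
  also have "\<dots> = rk M X" by (rule rk_Un_clos) (use assms finite_ground in auto)
  finally show ?thesis .
qed

lemma clos_trans:
  assumes "Z \<subseteq> clos M X"
  shows "clos M Z \<subseteq> clos M X"
proof
  fix e assume "e \<in> clos M Z"
  then have "e \<in> clos M (Z \<union> X)" using clos_mono[of Z "Z \<union> X"] by auto
  then have "rk M (insert e (Z \<union> X)) = rk M (Z \<union> X)" by (simp add: clos_def)
  also have "\<dots> \<le> rk M X"
    by (rule rk_le_if_subset_clos) (use assms clos_increasing in auto)
  finally have "rk M (insert e X) \<le> rk M X"
    using rk_mono[of "insert e X" "insert e (Z \<union> X)"] by (meson Un_upper2 insert_mono order_trans)
  then show "e \<in> clos M X" using rk_insert_mono[of X e] by (simp add: clos_def)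
qed

text \<open>The set with both elements has rank at most \<open>rk M X + 1\<close>, which
  \<open>insert f X\<close> already attains. This later makes being parallel a symmetric relation
  between labels.\<close>

lemma clos_exchange:
  assumes "f \<in> clos M (insert e X)" "f \<notin> clos M X"
  shows "e \<in> clos M (insert f X)"
proof -
  have "rk M (insert f X) = Suc (rk M X)"
    using assms(2) rk_insert_le[of f X] rk_insert_mono[of X f] by (simp add: clos_def)
  moreover have "rk M (insert e (insert f X)) = rk M (insert e X)"
    using assms(1) by (simp add: clos_def insert_commute)
  ultimately show ?thesis
    using rk_insert_le[of e X] rk_insert_mono[of "insert f X" e] by (simp add: clos_def)
qed

end

text \<open>With unit increments, the local form of submodularity in \<open>r_local\<close>
  suffices. It can be checked edge by edge, which suits functions such as \<open>grank\<close> and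
  \<open>lrank\<close> that are given by connectivity and switching.\<close>

locale rank_function =
  fixes E :: "'e set" and r :: "'e set \<Rightarrow> nat"
  assumes finite_E: "finite E"
    and r_empty: "r {} = 0"
    and r_insert_mono: "X \<subseteq> E \<Longrightarrow> e \<in> E \<Longrightarrow> r X \<le> r (insert e X)"
    and r_insert_le: "X \<subseteq> E \<Longrightarrow> e \<in> E \<Longrightarrow> r (insert e X) \<le> Suc (r X)"
    and r_local: "X \<subseteq> E \<Longrightarrow> e \<in> E \<Longrightarrow> f \<in> E \<Longrightarrow> r (insert e X) = r X \<Longrightarrow> r (insert f X) = r X \<Longrightarrow>
      r (insert e (insert f X)) = r X"
begin

definition rmat :: "'e indep_system" where
  "rmat = \<lparr>ground = E, indep = {X. X \<subseteq> E \<and> r X = card X}\<rparr>"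

lemma ground_rmat [simp]: "ground rmat = E"
  and indep_rmat: "X \<in> indep rmat \<longleftrightarrow> X \<subseteq> E \<and> r X = card X"
  by (simp_all add: rmat_def)

lemma finite_sub: "X \<subseteq> E \<Longrightarrow> finite X"
  using finite_E finite_subset by blast

lemma r_Un_eq:
  assumes "finite Z" "Z \<subseteq> E" "X \<subseteq> E" "\<And>e. e \<in> Z \<Longrightarrow> r (insert e X) = r X"
  shows "r (X \<union> Z) = r X"
  using assms
proof (induction Z arbitrary: X)
  case (insert f Z)
  have f: "r (insert f X) = r X" using insert.prems by simp
  have "r (insert e (insert f X)) = r (insert f X)" if "e \<in> Z" for e
    using r_local[of X e f] insert.prems that f by auto
  then have "r (insert f X \<union> Z) = r (insert f X)"
    using insert.IH[of "insert f X"] insert.prems by auto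
  then show ?case using f by simp
qed simp

lemma r_mono_le: "X \<subseteq> Y \<Longrightarrow> Y \<subseteq> E \<Longrightarrow> r X \<le> r Y \<and> r Y \<le> r X + card (Y - X)"
proof -
  have "r X \<le> r (X \<union> Z) \<and> r (X \<union> Z) \<le> r X + card Z" if "finite Z" "X \<subseteq> E" "Z \<subseteq> E" for X Z
    using that
  proof (induction Z)
    case (insert e Z)
    then show ?case using r_insert_mono[of "X \<union> Z" e] r_insert_le[of "X \<union> Z" e] by auto
  qed simp
  moreover assume "X \<subseteq> Y" "Y \<subseteq> E"
  ultimately have "r X \<le> r (X \<union> (Y - X)) \<and> r (X \<union> (Y - X)) \<le> r X + card (Y - X)"
    using finite_sub by (meson Diff_subset order_trans)
  then show ?thesis using \<open>X \<subseteq> Y\<close> by (simp add: Un_absorb1)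
qed

lemma r_mono: "X \<subseteq> Y \<Longrightarrow> Y \<subseteq> E \<Longrightarrow> r X \<le> r Y"
  using r_mono_le by blast

lemma r_le_card: "X \<subseteq> E \<Longrightarrow> r X \<le> card X"
  using r_mono_le[of "{}" X] r_empty by simp

lemma r_insert_indep:
  assumes "X \<in> indep rmat" "e \<in> E" "insert e X \<notin> indep rmat"
  shows "r (insert e X) = r X"
proof (cases "e \<in> X")
  case False
  then have "card (insert e X) = Suc (card X)" using assms finite_sub indep_rmat by simp
  then show ?thesis
    using assms r_insert_le[of X e] r_insert_mono[of X e] by (auto simp: indep_rmat)
qed (simp add: insert_absorb)

lemma matroid_rmat: "matroid rmat"
proof
  show "finite (ground rmat)" using finite_E by simp
  show "X \<subseteq> ground rmat" if "X \<in> indep rmat" for X using that by (simp add: indep_rmat)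
  show "{} \<in> indep rmat" by (simp add: indep_rmat r_empty)
  show "Y \<in> indep rmat" if "X \<in> indep rmat" "Y \<subseteq> X" for X Y
  proof -
    have "r X \<le> r Y + card (X - Y)" using that r_mono_le[of Y X] by (auto simp: indep_rmat)
    moreover have "card (X - Y) = card X - card Y" "card Y \<le> card X"
      using that finite_sub card_mono by (auto simp: indep_rmat card_Diff_subset finite_subset)
    moreover have "r Y \<le> card Y" using that r_le_card[of Y] by (auto simp: indep_rmat)
    ultimately show ?thesis using that by (auto simp: indep_rmat)
  qed
  show "\<exists>e\<in>Y - X. insert e X \<in> indep rmat"
    if "X \<in> indep rmat" "Y \<in> indep rmat" "card X < card Y" for X Y
  proof (rule ccontr)
    assume "\<not> ?thesis"
    then have "r (insert e X) = r X" if "e \<in> Y - X" for e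
      using that r_insert_indep[of X e] \<open>X \<in> indep rmat\<close> \<open>Y \<in> indep rmat\<close> indep_rmat by blast
    then have "r (X \<union> (Y - X)) = r X"
      using that r_Un_eq[of "Y - X" X] finite_sub by (auto simp: indep_rmat)
    then have "r Y \<le> r X" using r_mono[of Y "X \<union> Y"] that by (simp add: indep_rmat)
    then show False using that by (simp add: indep_rmat)
  qed
qed

text \<open>A largest independent \<open>B\<close> inside \<open>X\<close> cannot be enlarged, so no
  single element of \<open>X\<close> raises \<open>r B\<close>, and by \<open>r_Un_eq\<close>
  neither do all of them together.\<close>

lemma rk_rmat:
  assumes "X \<subseteq> E"
  shows "rk rmat X = r X"
proof -
  interpret matroid rmat by (rule matroid_rmat)
  obtain B where B: "B \<in> indep rmat" "B \<subseteq> X" "card B = rk rmat X" using rk_attained by blast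
  have "r (insert e B) = r B" if "e \<in> X - B" for e
  proof (rule r_insert_indep)
    show "insert e B \<notin> indep rmat"
      using card_le_rk[of "insert e B" X] B that finite_indep[OF B(1)] by auto
  qed (use assms that B in auto)
  then have "r (B \<union> (X - B)) = r B" using r_Un_eq[of "X - B" B] assms B finite_sub by auto
  then have "r X = r B" using B by (simp add: Un_absorb1)
  then show ?thesis using B by (simp add: indep_rmat)
qed

end

lemma (in matroid) rank_function_rk: "rank_function (ground M) (rk M)"
proof
  show "rk M (insert e (insert f X)) = rk M X"
    if "rk M (insert e X) = rk M X" "rk M (insert f X) = rk M X" for X e f
    using rk_Un_clos[of "{e, f}" X] that by (simp add: clos_def)
qed (simp_all add: finite_ground rk_insert_mono rk_insert_le)

text \<open>
  The case \<open>r1 = r\<^sub>L\<close>, \<open>r2 = r\<^sub>M\<close> of the next lemma is Higgs' lift construction: it works because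
  \<open>r1 - r2\<close> is monotone, so that \<open>r1\<close> is attained on small sets and \<open>r2 + k\<close> on large ones.
\<close>

lemma rank_function_min:
  assumes "rank_function E r1" "rank_function E r2"
    and mono: "\<And>X e. X \<subseteq> E \<Longrightarrow> e \<in> E \<Longrightarrow> r1 X + r2 (insert e X) \<le> r1 (insert e X) + r2 X"
  shows "rank_function E (\<lambda>X. min (r1 X) (r2 X + k))"
proof -
  interpret r1: rank_function E r1 by fact
  interpret r2: rank_function E r2 by fact
  show ?thesis
  proof
    fix X e f assume E: "X \<subseteq> E" "e \<in> E" "f \<in> E"
      and e: "min (r1 (insert e X)) (r2 (insert e X) + k) = min (r1 X) (r2 X + k)"
      and f: "min (r1 (insert f X)) (r2 (insert f X) + k) = min (r1 X) (r2 X + k)"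
    have *: "min (r1 X) (r2 X + k) \<le> min (r1 (insert e (insert f X))) (r2 (insert e (insert f X)) + k)"
      using r1.r_mono[of X "insert e (insert f X)"] r2.r_mono[of X "insert e (insert f X)"] E
      by (simp add: min.coboundedI1 min.coboundedI2 subset_insertI2)
    \<comment> \<open>The cases tell which term attains the minimum at \<open>X\<close>. A tie falls
      under the second one: if \<open>r2\<close> grew, then so would \<open>r1\<close> because the
      difference is monotone, and with them the minimum.\<close>
    consider "r1 (insert e X) = r1 X" "r1 (insert f X) = r1 X" "r1 X \<le> r2 X + k"
      | "r2 (insert e X) = r2 X" "r2 (insert f X) = r2 X" "r2 X + k \<le> r1 X"
      using e f mono[OF E(1,2)] mono[OF E(1,3)]
        r1.r_insert_mono[OF E(1,2)] r1.r_insert_mono[OF E(1,3)]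
        r2.r_insert_mono[OF E(1,2)] r2.r_insert_mono[OF E(1,3)]
      by (auto simp: min_def split: if_splits)
    then show "min (r1 (insert e (insert f X))) (r2 (insert e (insert f X)) + k) = min (r1 X) (r2 X + k)"
    proof cases
      case 1
      then show ?thesis using r1.r_local[OF E] * by (auto simp: min_def split: if_splits)
    next
      case 2
      then show ?thesis using r2.r_local[OF E] * by (auto simp: min_def split: if_splits)
    qed
  next
    fix X e assume E: "X \<subseteq> E" "e \<in> E"
    show "min (r1 X) (r2 X + k) \<le> min (r1 (insert e X)) (r2 (insert e X) + k)"
      using r1.r_insert_mono[OF E] r2.r_insert_mono[OF E] by auto
    show "min (r1 (insert e X)) (r2 (insert e X) + k) \<le> Suc (min (r1 X) (r2 X + k))"
      using r1.r_insert_le[OF E] r2.r_insert_le[OF E] by auto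
  qed (simp_all add: r1.finite_E r1.r_empty)
qed

section \<open>Lifts\<close>

lemma rk_delete:
  assumes "A \<subseteq> ground M - Z"
  shows "rk (delete M Z) A = rk M A"
proof -
  have "{Y \<in> indep (delete M Z). Y \<subseteq> A} = {Y \<in> indep M. Y \<subseteq> A}"
    using assms by (auto simp: delete_def)
  then show ?thesis by (simp add: rk_def)
qed

lemma rk_relabel:
  assumes "inj f"
  shows "rk (relabel f M) (f ` X) = rk M X"
proof -
  have "{Y \<in> indep (relabel f M). Y \<subseteq> f ` X} = (`) f ` {Y \<in> indep M. Y \<subseteq> X}"
    using assms by (auto simp: relabel_def inj_image_subset_iff)
  then have "card ` {Y \<in> indep (relabel f M). Y \<subseteq> f ` X} = card ` {Y \<in> indep M. Y \<subseteq> X}"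
    using assms by (simp add: image_image card_image inj_on_subset)
  then show ?thesis by (simp add: rk_def)
qed

context matroid
begin

lemma basis_of_iff: "basis_of M Z B \<longleftrightarrow> B \<in> indep M \<and> B \<subseteq> Z \<and> card B = rk M Z"
proof
  assume B: "basis_of M Z B"
  then obtain B' where "B' \<in> indep M" "B \<subseteq> B'" "B' \<subseteq> Z" "card B' = rk M Z"
    using extend_to_basis by (metis basis_of_def)
  then show "B \<in> indep M \<and> B \<subseteq> Z \<and> card B = rk M Z" using B by (auto simp: basis_of_def)
next
  assume B: "B \<in> indep M \<and> B \<subseteq> Z \<and> card B = rk M Z"
  have "B' = B" if "B \<subseteq> B'" "B' \<subseteq> Z" "B' \<in> indep M" for B'
    using that B card_le_rk[of B' Z] card_mono[of B' B] card_subset_eq[of B' B] finite_indep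
    by (metis le_antisym)
  then show "basis_of M Z B" using B by (auto simp: basis_of_def)
qed

lemma rk_contract:
  assumes "A \<subseteq> ground M - Z"
  shows "rk (contract M Z) A + rk M Z = rk M (A \<union> Z)"
proof -
  let ?S = "{Y \<in> indep (contract M Z). Y \<subseteq> A}"
  have "finite A" using assms finite_ground finite_subset by blast
  have "rk (contract M Z) A = rk M (A \<union> Z) - rk M Z"
    unfolding rk_def[of "contract M Z"]
  proof (rule Max_eqI)
    show "finite (card ` ?S)" using \<open>finite A\<close> by simp
    show "y \<le> rk M (A \<union> Z) - rk M Z" if y: "y \<in> card ` ?S" for y
    proof -
      obtain Y B where Y: "y = card Y" "Y \<subseteq> A" "Y \<union> B \<in> indep M" "basis_of M Z B"
        using y by (auto simp: contract_def)
      have B: "B \<subseteq> Z" "card B = rk M Z" "finite B" using Y basis_of_iff finite_indep by blast+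
      have "card (Y \<union> B) = card Y + card B"
        by (rule card_Un_disjoint) (use B Y assms \<open>finite A\<close> finite_subset in auto)
      moreover have "card (Y \<union> B) \<le> rk M (A \<union> Z)" by (rule card_le_rk) (use Y B in auto)
      ultimately show ?thesis using Y B by simp
    qed
    obtain B where B: "B \<in> indep M" "B \<subseteq> Z" "card B = rk M Z" using rk_attained by blast
    obtain C where C: "C \<in> indep M" "B \<subseteq> C" "C \<subseteq> A \<union> Z" "card C = rk M (A \<union> Z)"
      using extend_to_basis[of B "A \<union> Z"] B by blast
    have basis: "basis_of M Z B" using B basis_of_iff by blast
    \<comment> \<open>\<open>C \<inter> Z\<close> is an independent subset of \<open>Z\<close> that
      contains the basis \<open>B\<close>; maximality leaves no room for more.\<close>
    have "C \<inter> Z = B"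
      using basis indep_subset[OF C(1), of "C \<inter> Z"] B C by (auto simp: basis_of_def)
    then have CB: "C - B \<subseteq> A" "(C - B) \<union> B = C" using C by auto
    have "C - B \<in> ?S" using CB basis assms C by (auto simp: contract_def)
    moreover have "card (C - B) = rk M (A \<union> Z) - rk M Z"
      using B C finite_indep by (simp add: card_Diff_subset)
    ultimately show "rk M (A \<union> Z) - rk M Z \<in> card ` ?S" by (metis imageI)
  qed
  then show ?thesis using rk_mono[of Z "A \<union> Z"] by simp
qed

end

text \<open>In the common extension \<open>K\<close> the excess of \<open>X\<close> is
  \<open>rk K X + rk K F - rk K (X \<union> F)\<close>, the slack of submodularity between
  \<open>X\<close> and \<open>F\<close>. Submodularity for \<open>Y\<close> and
  \<open>X \<union> F\<close> shows that it grows with \<open>X\<close>.\<close>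

lemma is_lift_rk_le:
  assumes "is_lift L M" "X \<subseteq> Y" "Y \<subseteq> ground M"
  shows "rk L X + rk M Y \<le> rk L Y + rk M X"
proof -
  obtain K :: "('a + nat) indep_system" and F :: "nat set" where
    K: "matroid K" "ground K = Inl ` ground M \<union> Inr ` F"
      "relabel Inl M = contract K (Inr ` F)" "relabel Inl L = delete K (Inr ` F)"
    using assms(1) unfolding is_lift_def by blast
  interpret K: matroid K by fact
  let ?F = "Inr ` F :: ('a + nat) set"
  have ground: "Inl ` Z \<subseteq> ground K - ?F" if "Z \<subseteq> ground M" for Z :: "'a set"
    using that K(2) by auto
  have L: "rk L Z = rk K (Inl ` Z)" if "Z \<subseteq> ground M" for Z
    using rk_relabel[of "Inl :: 'a \<Rightarrow> 'a + nat" L Z] rk_delete[OF ground[OF that]] K(4) by simp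
  have M: "rk M Z + rk K ?F = rk K (Inl ` Z \<union> ?F)" if "Z \<subseteq> ground M" for Z
    using rk_relabel[of "Inl :: 'a \<Rightarrow> 'a + nat" M Z] K.rk_contract[OF ground[OF that]] K(3) by simp
  have "Inl ` Y \<union> (Inl ` X \<union> ?F) = Inl ` Y \<union> ?F" "Inl ` Y \<inter> (Inl ` X \<union> ?F) = Inl ` X"
    using assms(2) by auto
  then have "rk K (Inl ` Y \<union> ?F) + rk K (Inl ` X) \<le> rk K (Inl ` Y) + rk K (Inl ` X \<union> ?F)"
    using K.rk_submodular[of "Inl ` Y" "Inl ` X \<union> ?F"] by simp
  moreover have "X \<subseteq> ground M" using assms by blast
  ultimately show ?thesis using L[of X] L[of Y] M[of X] M[of Y] assms(3) by simp
qed

lemma is_liftI: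
  fixes L M :: "'e indep_system"
  assumes "matroid L" "matroid M" "ground L = ground M"
    and mono: "\<And>X Y. X \<subseteq> Y \<Longrightarrow> Y \<subseteq> ground M \<Longrightarrow> rk L X + rk M Y \<le> rk L Y + rk M X"
  shows "is_lift L M"
proof -
  interpret L: matroid L by fact
  interpret M: matroid M by fact
  \<comment> \<open>The total excess. By monotonicity it bounds the excess of every set, so the
    minimum in \<open>r\<close> is \<open>rk L\<close> when no new element is present and
    \<open>rk M + k\<close> when all are: deletion gives \<open>L\<close> and contraction gives
    \<open>M\<close>.\<close>
  define k where "k = rk L (ground M) - rk M (ground M)"
  define pl :: "('e + nat) set \<Rightarrow> 'e set" where "pl Z = Inl -` Z" for Z
  define pr :: "('e + nat) set \<Rightarrow> nat set" where "pr Z = Inr -` Z" for Z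
  have pl_simps [simp]: "pl {} = {}" "pl (insert (Inl a) Z) = insert a (pl Z)"
      "pl (insert (Inr m) Z) = pl Z" "pl (Inl ` A \<union> Inr ` B) = A" "pl (Inl ` A) = A" "pl (Inr ` B) = {}"
    and pr_simps [simp]: "pr {} = {}" "pr (insert (Inl a) Z) = pr Z"
      "pr (insert (Inr m) Z) = insert m (pr Z)" "pr (Inl ` A \<union> Inr ` B) = B" "pr (Inl ` A) = {}" "pr (Inr ` B) = B"
    for a m Z A B
    by (auto simp: pl_def pr_def)
  let ?E = "Inl ` ground M \<union> Inr ` {..<k} :: ('e + nat) set"
  define r where "r Z = min (rk L (pl Z) + card (pr Z)) (rk M (pl Z) + k)" for Z
  have pl: "pl Z \<subseteq> ground M" and pr: "pr Z \<subseteq> {..<k}" "finite (pr Z)" if "Z \<subseteq> ?E" for Z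
  proof -
    show "pl Z \<subseteq> ground M" "pr Z \<subseteq> {..<k}" using that by (auto simp: pl_def pr_def)
    then show "finite (pr Z)" using finite_subset by blast
  qed
  have "rank_function ?E (\<lambda>Z. rk L (pl Z) + card (pr Z))"
  proof
    fix X e f assume X: "X \<subseteq> ?E" "e \<in> ?E" "f \<in> ?E"
      and "rk L (pl (insert e X)) + card (pr (insert e X)) = rk L (pl X) + card (pr X)"
      and "rk L (pl (insert f X)) + card (pr (insert f X)) = rk L (pl X) + card (pr X)"
    then show "rk L (pl (insert e (insert f X))) + card (pr (insert e (insert f X)))
      = rk L (pl X) + card (pr X)"
      using pr(2)[OF X(1)] rank_function.r_local[OF L.rank_function_rk] pl[OF X(1)] assms(3)
      by (auto simp: card_insert_if split: if_splits)
  next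
    fix X e assume X: "X \<subseteq> ?E" "e \<in> ?E"
    then show "rk L (pl X) + card (pr X) \<le> rk L (pl (insert e X)) + card (pr (insert e X))"
      "rk L (pl (insert e X)) + card (pr (insert e X)) \<le> Suc (rk L (pl X) + card (pr X))"
      using pr(2)[OF X(1)] by (auto simp: card_insert_if L.rk_insert_mono L.rk_insert_le)
  qed (simp_all add: M.finite_ground)
  moreover have "rank_function ?E (\<lambda>Z. rk M (pl Z))"
  proof
    fix X e f assume X: "X \<subseteq> ?E" "e \<in> ?E" "f \<in> ?E"
      and "rk M (pl (insert e X)) = rk M (pl X)" and "rk M (pl (insert f X)) = rk M (pl X)"
    then show "rk M (pl (insert e (insert f X))) = rk M (pl X)"
      using rank_function.r_local[OF M.rank_function_rk] pl[OF X(1)] by auto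
  next
    fix X e assume X: "X \<subseteq> ?E" "e \<in> ?E"
    then show "rk M (pl X) \<le> rk M (pl (insert e X))" "rk M (pl (insert e X)) \<le> Suc (rk M (pl X))"
      by (auto simp: M.rk_insert_mono M.rk_insert_le)
  qed (simp_all add: M.finite_ground)
  ultimately have "rank_function ?E r"
    unfolding r_def
  proof (rule rank_function_min)
    fix X e assume X: "X \<subseteq> ?E" "e \<in> ?E"
    show "rk L (pl X) + card (pr X) + rk M (pl (insert e X))
      \<le> rk L (pl (insert e X)) + card (pr (insert e X)) + rk M (pl X)"
      using X(2) mono[of "pl X" "pl (insert e X)"] pl[of "insert e X"] pl[OF X(1)] pr(2)[OF X(1)] X
      by (auto simp: card_insert_if subset_insertI)
  qed
  then interpret r: rank_function ?E r .
  let ?K = r.rmat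
  interpret K: matroid ?K by (rule r.matroid_rmat)
  have indep_K: "Inl ` X \<union> Inr ` S \<in> indep ?K \<longleftrightarrow>
      min (rk L X + card S) (rk M X + k) = card X + card S" if "X \<subseteq> ground M" "S \<subseteq> {..<k}" for X S
  proof -
    have "card (Inl ` X \<union> Inr ` S :: ('e + nat) set) = card X + card S"
      using that finite_subset[OF that(1) M.finite_ground] finite_subset[OF that(2)]
      by (subst card_Un_disjoint) (auto simp: card_image)
    moreover have "Inl ` X \<union> Inr ` S \<subseteq> ?E" using that by auto
    ultimately show ?thesis by (simp add: r.indep_rmat r_def)
  qed
  have LM: "rk M X \<le> rk L X" "rk L X \<le> rk M X + k" if "X \<subseteq> ground M" for X
  proof -
    show "rk M X \<le> rk L X" using mono[of "{}" X] that by simp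
    have "rk M (ground M) \<le> rk L (ground M)" using mono[of "{}" "ground M"] by simp
    then show "rk L X \<le> rk M X + k" using mono[of X "ground M"] that by (simp add: k_def)
  qed
  \<comment> \<open>The new elements are independent in \<open>?K\<close>, so the existential over
    bases in \<open>contract\<close> has just one candidate.\<close>
  have basis: "basis_of ?K (Inr ` {..<k}) B \<longleftrightarrow> B = Inr ` {..<k}" for B
  proof -
    have "Inr ` {..<k} \<in> indep ?K" using indep_K[of "{}" "{..<k}"] by simp
    then show ?thesis unfolding basis_of_def by (metis subset_refl subset_antisym)
  qed
  have diff: "?E - Inr ` {..<k} = Inl ` ground M" by auto
  have "indep (relabel Inl L) = indep (delete ?K (Inr ` {..<k}))"
  proof (rule Set.set_eqI)
    fix Y :: "('e + nat) set"
    have "Inl ` X \<in> indep ?K \<longleftrightarrow> X \<in> indep L" if "X \<subseteq> ground M" for X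
      using indep_K[OF that, of "{}"] L.indep_iff_rk[of X] LM[OF that]
        finite_subset[OF that M.finite_ground] by (simp add: min_def)
    moreover have "Y \<in> indep (delete ?K (Inr ` {..<k})) \<longleftrightarrow>
        (\<exists>X \<subseteq> ground M. Y = Inl ` X \<and> Inl ` X \<in> indep ?K)"
      by (auto simp: delete_def diff subset_image_iff)
    ultimately show "Y \<in> indep (relabel Inl L) \<longleftrightarrow> Y \<in> indep (delete ?K (Inr ` {..<k}))"
      using L.indep_subset_ground assms(3) by (auto simp: relabel_def)
  qed
  moreover have "indep (relabel Inl M) = indep (contract ?K (Inr ` {..<k}))"
  proof (rule Set.set_eqI)
    fix Y :: "('e + nat) set"
    have "Inl ` X \<union> Inr ` {..<k} \<in> indep ?K \<longleftrightarrow> X \<in> indep M" if "X \<subseteq> ground M" for X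
      using indep_K[OF that, of "{..<k}"] M.indep_iff_rk[of X] LM[OF that]
        finite_subset[OF that M.finite_ground] by (simp add: min_def)
    moreover have "Y \<in> indep (contract ?K (Inr ` {..<k})) \<longleftrightarrow>
        (\<exists>X \<subseteq> ground M. Y = Inl ` X \<and> Inl ` X \<union> Inr ` {..<k} \<in> indep ?K)"
      by (auto simp: contract_def diff basis subset_image_iff)
    ultimately show "Y \<in> indep (relabel Inl M) \<longleftrightarrow> Y \<in> indep (contract ?K (Inr ` {..<k}))"
      using M.indep_subset_ground by (auto simp: relabel_def)
  qed
  ultimately have "relabel Inl M = contract ?K (Inr ` {..<k})"
    "relabel Inl L = delete ?K (Inr ` {..<k})"
    using assms(3) by (simp_all add: relabel_def contract_def delete_def diff)
  then show ?thesis
    using assms K.matroid_axioms r.ground_rmat unfolding is_lift_def by metis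
qed

section \<open>The cycle matroid of a multigraph\<close>

text \<open>Any prescribed edge of a cycle can thus be made the last one of a traversal, which
  leaves a path in front of it.\<close>

lemma cycle_traversal_rotate:
  assumes "cycle_traversal E ends vs es"
  shows "cycle_traversal E ends (rotate m vs) (rotate m es)"
proof -
  let ?l = "length es"
  have l: "length vs = ?l" "es \<noteq> []"
    and ends: "\<And>i. i < ?l \<Longrightarrow> ends (es ! i) = {vs ! i, vs ! (Suc i mod ?l)}"
    using assms by (auto simp: cycle_traversal_def)
  have "ends (rotate m es ! i) = {rotate m vs ! i, rotate m vs ! (Suc i mod ?l)}" if "i < ?l" for i
  proof -
    have "Suc ((m + i) mod ?l) mod ?l = (m + Suc i mod ?l) mod ?l" by (simp add: mod_simps)
    then show ?thesis using that l ends[of "(m + i) mod ?l"] by (simp add: nth_rotate)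
  qed
  then show ?thesis using assms l by (simp add: cycle_traversal_def)
qed

locale multigraph =
  fixes E :: "'e set" and ends :: "'e \<Rightarrow> 'v::wellorder set"
  assumes finite_edges: "finite E"
    and ends_E: "e \<in> E \<Longrightarrow> \<exists>u v. u \<noteq> v \<and> ends e = {u, v}"
begin

definition conn :: "'e set \<Rightarrow> 'v \<Rightarrow> 'v \<Rightarrow> bool" where
  "conn X = (\<lambda>u v. \<exists>e\<in>X. ends e = {u, v})\<^sup>*\<^sup>*"

lemma conn_refl [simp]: "conn X u u"
  by (simp add: conn_def)

lemma conn_edge: "e \<in> X \<Longrightarrow> ends e = {u, v} \<Longrightarrow> conn X u v"
  unfolding conn_def by (rule r_into_rtranclp) auto

lemma conn_trans: "conn X u v \<Longrightarrow> conn X v w \<Longrightarrow> conn X u w"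
  by (simp add: conn_def)

lemma conn_sym: "conn X u v \<Longrightarrow> conn X v u"
proof -
  have "symp (\<lambda>u v. \<exists>e\<in>X. ends e = {u, v})" by (auto simp: symp_def insert_commute)
  then show "conn X u v \<Longrightarrow> conn X v u" unfolding conn_def by (meson symp_rtranclp sympD)
qed

lemma conn_mono: "conn X u v \<Longrightarrow> X \<subseteq> Y \<Longrightarrow> conn Y u v"
  unfolding conn_def by (erule rtranclp_mono[THEN predicate2D, rotated]) auto

lemma conn_imp_incident: "conn X u v \<Longrightarrow> u \<noteq> v \<Longrightarrow> \<exists>e\<in>X. v \<in> ends e"
  unfolding conn_def by (erule rtranclp.cases) auto

lemma conn_insert:
  assumes "ends e = {a, b}"
  shows "conn (insert e X) u v \<longleftrightarrow>
    conn X u v \<or> conn X u a \<and> conn X b v \<or> conn X u b \<and> conn X a v"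
proof
  assume "conn (insert e X) u v"
  then show "conn X u v \<or> conn X u a \<and> conn X b v \<or> conn X u b \<and> conn X a v"
    unfolding conn_def[of "insert e X"]
  proof (induction rule: rtranclp_induct)
    case (step y z)
    then consider "conn X y z" | "{a, b} = {y, z}" using assms conn_edge by blast
    then show ?case
    proof cases
      case 1
      then show ?thesis using step.IH conn_trans by blast
    next
      case 2
      then have "a = y \<and> b = z \<or> a = z \<and> b = y" by (auto simp: doubleton_eq_iff)
      then show ?thesis using step.IH[folded conn_def] conn_refl by (elim disjE conjE) simp_all
    qed
  qed simp
next
  have "conn (insert e X) a b" using assms conn_edge by blast
  then show "conn (insert e X) u v"
    if "conn X u v \<or> conn X u a \<and> conn X b v \<or> conn X u b \<and> conn X a v"
    using that conn_mono[of X _ _ "insert e X"] conn_trans conn_sym by (meson subset_insertI)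
qed

text \<open>
  The vertices that are not the least ones of their component: their number is the number of
  vertices minus the number of components.
\<close>

definition non_roots :: "'e set \<Rightarrow> 'v set" where
  "non_roots X = {v. \<exists>u<v. conn X u v}"

definition grank :: "'e set \<Rightarrow> nat" where
  "grank X = card (non_roots X)"

lemma finite_non_roots:
  assumes "X \<subseteq> E"
  shows "finite (non_roots X)"
proof (rule finite_subset)
  show "non_roots X \<subseteq> \<Union> (ends ` X)" using conn_imp_incident by (fastforce simp: non_roots_def)
  have "finite (ends e)" if "e \<in> E" for e using ends_E[OF that] by auto
  moreover have "finite X" using assms finite_edges finite_subset by blast
  ultimately show "finite (\<Union> (ends ` X))" using assms by blast
qed

lemma grank_insert_conn:
  assumes "ends e = {a, b}" "conn X a b"
  shows "grank (insert e X) = grank X"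
proof -
  have "conn (insert e X) u v = conn X u v" for u v
    using conn_insert[OF assms(1)] assms(2) conn_sym[OF assms(2)] by (meson conn_trans)
  then show ?thesis by (simp add: grank_def non_roots_def)
qed

text \<open>When two components are joined, the smaller of their two least vertices stays a root and
  the larger one becomes the only new non-root.\<close>

lemma grank_insert_not_conn:
  assumes "X \<subseteq> E" "e \<in> E" "ends e = {a, b}" "\<not> conn X a b"
  shows "grank (insert e X) = Suc (grank X)"
proof -
  define root where "root v = (LEAST u. conn X u v)" for v
  have root: "conn X (root v) v" "conn X u v \<Longrightarrow> root v \<le> u" for u v
    unfolding root_def by (rule LeastI[of "\<lambda>u. conn X u v" v], simp) (rule Least_le)
  have *: "grank (insert e X) = Suc (grank X)" if ab: "ends e = {a, b}" "root a < root b" for a b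
  proof -
    have "non_roots (insert e X) = insert (root b) (non_roots X)"
    proof (intro equalityI subsetI)
      fix v assume "v \<in> non_roots (insert e X)"
      then obtain u where "u < v"
        "conn X u v \<or> conn X u a \<and> conn X b v \<or> conn X u b \<and> conn X a v"
        by (auto simp: non_roots_def conn_insert[OF ab(1)])
      then consider "conn X u v" | "conn X b v" | "conn X u b" "conn X a v" by blast
      then show "v \<in> insert (root b) (non_roots X)"
      proof cases
        case 2
        then have "root b \<le> v" "conn X (root b) v" using root conn_sym conn_trans by blast+
        then show ?thesis by (auto simp: non_roots_def le_less)
      next
        case 3
        then have "root b \<le> u" "conn X (root a) v" using root conn_sym conn_trans by blast+
        moreover have "root a < v" using ab(2) \<open>root b \<le> u\<close> \<open>u < v\<close> by simp
        ultimately show ?thesis by (auto simp: non_roots_def)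
      qed (use \<open>u < v\<close> in \<open>auto simp: non_roots_def\<close>)
    next
      fix v assume "v \<in> insert (root b) (non_roots X)"
      moreover have "conn (insert e X) (root a) (root b)"
        using root conn_sym by (simp add: conn_insert[OF ab(1)])
      ultimately show "v \<in> non_roots (insert e X)"
        using ab(2) conn_mono[of X _ _ "insert e X"] by (auto simp: non_roots_def)
    qed
    moreover have "root b \<notin> non_roots X"
      using root conn_trans by (fastforce simp: non_roots_def)
    ultimately show ?thesis using finite_non_roots[OF assms(1)] by (simp add: grank_def)
  qed
  have "root a \<noteq> root b" using assms(4) root conn_sym conn_trans by metis
  then show ?thesis using * assms(3) by (metis insert_commute neqE)
qed

lemma rank_function_grank: "rank_function E grank"
proof
  show "finite E" by (rule finite_edges)
  have "u = v" if "conn {} u v" for u v using conn_imp_incident[OF that] by auto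
  then have "non_roots {} = {}" by (fastforce simp: non_roots_def)
  then show "grank {} = 0" by (simp add: grank_def)
next
  fix X e assume X: "X \<subseteq> E" "e \<in> E"
  then obtain a b where "ends e = {a, b}" using ends_E by blast
  then show "grank X \<le> grank (insert e X)" "grank (insert e X) \<le> Suc (grank X)"
    using grank_insert_conn grank_insert_not_conn[OF X]
    by (metis le_refl le_SucI)+
next
  fix X e f assume X: "X \<subseteq> E" "e \<in> E" "f \<in> E"
    and eq: "grank (insert e X) = grank X" "grank (insert f X) = grank X"
  obtain a b c d where ab: "ends e = {a, b}" "ends f = {c, d}" using ends_E X by metis
  then have "conn X a b" using grank_insert_not_conn[OF X(1,2)] eq by fastforce
  then have "conn (insert f X) a b" using conn_mono by blast
  then show "grank (insert e (insert f X)) = grank X" using ab eq grank_insert_conn by metis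
qed

sublocale rank_function E grank
  by (rule rank_function_grank)

lemma grank_insert_eq_iff:
  assumes "X \<subseteq> E" "e \<in> E" "ends e = {a, b}"
  shows "grank (insert e X) = grank X \<longleftrightarrow> conn X a b"
  using assms grank_insert_conn grank_insert_not_conn by (metis n_not_Suc_n)

lemma grank_eq_card_iff:
  assumes "X \<subseteq> E"
  shows "grank X = card X \<longleftrightarrow> (\<forall>e\<in>X. \<forall>a b. ends e = {a, b} \<longrightarrow> \<not> conn (X - {e}) a b)"
proof (intro iffI ballI allI impI notI)
  fix e a b assume "grank X = card X" "e \<in> X" "ends e = {a, b}" "conn (X - {e}) a b"
  then have "grank X = grank (X - {e})"
    using grank_insert_conn[of e a b "X - {e}"] by (simp add: insert_absorb)
  also have "\<dots> \<le> card (X - {e})" by (rule r_le_card) (use assms in auto)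
  also have "\<dots> < card X" using \<open>e \<in> X\<close> finite_sub[OF assms] by (metis card_Diff1_less)
  finally show False using \<open>grank X = card X\<close> by simp
next
  assume *: "\<forall>e\<in>X. \<forall>a b. ends e = {a, b} \<longrightarrow> \<not> conn (X - {e}) a b"
  have "grank Y = card Y" if "finite Y" "Y \<subseteq> X" for Y
    using that
  proof (induction Y)
    case (insert e Y)
    obtain a b where ab: "ends e = {a, b}" using ends_E insert.prems assms by blast
    then have "\<not> conn (X - {e}) a b" using * insert.prems by auto
    then have "\<not> conn Y a b" using conn_mono[of Y a b "X - {e}"] insert by blast
    then show ?case using grank_insert_not_conn[of Y e a b] insert assms ab by auto
  qed (simp add: r_empty)
  then show "grank X = card X" using finite_sub assms by simp
qed

text \<open>As long as the closing edge is left out, each edge leads to a vertex that no earlier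
  edge meets, so it joins two components and raises the rank.\<close>

lemma traversal_prefix:
  assumes "cycle_traversal E ends vs es" "k < length es"
  shows "grank (set (take k es)) = k" "conn (set (take k es)) (vs ! 0) (vs ! k)"
proof -
  have l: "length vs = length es" "distinct vs" "distinct es" "set es \<subseteq> E"
    and ends: "\<And>i. i < length es \<Longrightarrow> ends (es ! i) = {vs ! i, vs ! (Suc i mod length es)}"
    using assms by (auto simp: cycle_traversal_def)
  have "grank (set (take k es)) = k \<and> conn (set (take k es)) (vs ! 0) (vs ! k)" using assms(2)
  proof (induction k)
    case (Suc k)
    let ?X = "set (take k es)"
    have X: "set (take (Suc k) es) = insert (es ! k) ?X"
      using Suc.prems by (simp add: take_Suc_conv_app_nth)
    have e: "ends (es ! k) = {vs ! k, vs ! Suc k}" using ends[of k] Suc.prems by simp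
    have "vs ! Suc k \<notin> ends f" if "f \<in> ?X" for f
    proof -
      obtain i where "f = es ! i" "i < k" using \<open>f \<in> ?X\<close> Suc.prems by (auto simp: in_set_conv_nth)
      then show ?thesis using ends[of i] Suc.prems l by (auto simp: nth_eq_iff_index_eq)
    qed
    moreover have "vs ! k \<noteq> vs ! Suc k" using l Suc.prems by (simp add: nth_eq_iff_index_eq)
    ultimately have "\<not> conn ?X (vs ! k) (vs ! Suc k)" using conn_imp_incident by blast
    moreover have "?X \<subseteq> E" "es ! k \<in> E" using l Suc.prems set_take_subset by fastforce+
    ultimately have "grank (insert (es ! k) ?X) = Suc (grank ?X)"
      using grank_insert_not_conn e by blast
    moreover have "conn (insert (es ! k) ?X) (vs ! 0) (vs ! Suc k)"
      using Suc e by (simp add: conn_insert)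
    ultimately show ?case using Suc X by simp
  qed (simp add: r_empty)
  then show "grank (set (take k es)) = k" "conn (set (take k es)) (vs ! 0) (vs ! k)" by auto
qed

lemma graph_cycle_remove:
  assumes "graph_cycle E ends C" "e \<in> C"
  shows "grank (C - {e}) = card (C - {e})" "\<exists>a b. ends e = {a, b} \<and> conn (C - {e}) a b"
proof -
  obtain vs es where t: "cycle_traversal E ends vs es" "C = set es"
    using assms by (auto simp: graph_cycle_def)
  obtain i where i: "i < length es" "es ! i = e" using assms t by (auto simp: in_set_conv_nth)
  \<comment> \<open>Rotation by \<open>Suc i\<close> moves the edge at position \<open>i\<close> to
    the end of the list.\<close>
  define us fs where "us = rotate (Suc i) vs" and "fs = rotate (Suc i) es"
  have t': "cycle_traversal E ends us fs" "C = set fs"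
    using cycle_traversal_rotate[OF t(1)] t(2) by (simp_all add: us_def fs_def del: rotate_Suc)
  define k where "k = length fs - 1"
  have k: "length fs = Suc k" using t' by (simp add: k_def cycle_traversal_def)
  have "(Suc i + k) mod length es = i"
    using i k by (metis add_Suc_shift fs_def length_rotate mod_add_self2 mod_less)
  then have e: "fs ! k = e" using i k by (simp add: fs_def nth_rotate del: rotate_Suc)
  have fs: "fs = take k fs @ [e]" using take_Suc_conv_app_nth[of k fs] k e by simp
  have "set fs = insert e (set (take k fs))" using arg_cong[OF fs, of set] by simp
  moreover have "e \<notin> set (take k fs)"
    using t' arg_cong[OF fs, of distinct] by (simp add: cycle_traversal_def)
  ultimately have C: "C - {e} = set (take k fs)" using t' by simp
  have "distinct (take k fs)" using t' by (simp add: cycle_traversal_def)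
  then have "card (C - {e}) = k" using C k by (simp add: distinct_card)
  then show "grank (C - {e}) = card (C - {e})" using traversal_prefix(1)[OF t'(1), of k] C k by simp
  have "ends e = {us ! k, us ! 0}" using t'(1) k e by (auto simp: cycle_traversal_def)
  then show "\<exists>a b. ends e = {a, b} \<and> conn (C - {e}) a b"
    using traversal_prefix(2)[OF t'(1), of k] C k conn_sym by auto
qed

lemma conn_simple_path:
  assumes "conn X a b"
  shows "\<exists>vs es. length vs = Suc (length es) \<and> distinct vs \<and> set es \<subseteq> X \<and>
    (\<forall>i<length es. ends (es ! i) = {vs ! i, vs ! Suc i}) \<and> vs ! 0 = a \<and> vs ! length es = b"
  using assms unfolding conn_def
proof (induction rule: rtranclp_induct)
  case base
  show ?case by (rule exI[of _ "[a]"], rule exI[of _ "[]"]) simp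
next
  case (step y z)
  then obtain vs es e where p: "length vs = Suc (length es)" "distinct vs" "set es \<subseteq> X"
      "\<forall>i<length es. ends (es ! i) = {vs ! i, vs ! Suc i}" "vs ! 0 = a" "vs ! length es = y"
    and e: "e \<in> X" "ends e = {y, z}" by blast
  show ?case
  proof (cases "z \<in> set vs")
    case True
    then obtain k where k: "k < length vs" "vs ! k = z" by (auto simp: in_set_conv_nth)
    have "set (take k es) \<subseteq> X" using p(3) set_take_subset by fast
    moreover have "min (length es) k = k" using k p(1) by simp
    ultimately show ?thesis using p k
      by (intro exI[of _ "take (Suc k) vs"] exI[of _ "take k es"]) auto
  next
    case False
    then show ?thesis using p e
      by (intro exI[of _ "vs @ [z]"] exI[of _ "es @ [e]"]) (auto simp: nth_append less_Suc_eq)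
  qed
qed

text \<open>A simple path in \<open>X - {e}\<close> is closed by \<open>e\<close>. Its edges are
  distinct because its vertices are, and \<open>e\<close> is new because the path avoids it; a path
  of one edge yields a digon.\<close>

lemma graph_cycle_through:
  assumes "X \<subseteq> E" "e \<in> X" "ends e = {a, b}" "conn (X - {e}) a b"
  shows "\<exists>C \<subseteq> X. graph_cycle E ends C"
proof -
  obtain vs es where p: "length vs = Suc (length es)" "distinct vs" "set es \<subseteq> X - {e}"
      "\<And>i. i < length es \<Longrightarrow> ends (es ! i) = {vs ! i, vs ! Suc i}" "vs ! 0 = a" "vs ! length es = b"
    using conn_simple_path[OF assms(4)] by blast
  have "distinct es"
    unfolding distinct_conv_nth
  proof (intro allI impI notI)
    fix i j assume "i < length es" "j < length es" "i \<noteq> j" "es ! i = es ! j"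
    then have "{vs ! i, vs ! Suc i} = {vs ! j, vs ! Suc j}" using p(4) by metis
    then show False using \<open>i \<noteq> j\<close> \<open>i < length es\<close> \<open>j < length es\<close> p(1,2)
      by (auto simp: doubleton_eq_iff nth_eq_iff_index_eq)
  qed
  moreover have "ends ((es @ [e]) ! i) = {vs ! i, vs ! (Suc i mod length (es @ [e]))}"
    if "i < length (es @ [e])" for i
  proof (cases "i = length es")
    case False
    then have "Suc i mod length (es @ [e]) = Suc i" using that by (simp add: mod_less)
    then show ?thesis using p(4)[of i] that False by (simp add: nth_append)
  qed (use p assms(3) in \<open>simp add: insert_commute\<close>)
  ultimately have "cycle_traversal E ends vs (es @ [e])"
    using p assms(1,2) unfolding cycle_traversal_def by auto
  then have "graph_cycle E ends (set (es @ [e]))" unfolding graph_cycle_def by blast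
  then show ?thesis using p assms(2) by (intro exI[of _ "set (es @ [e])"]) auto
qed

lemma cycle_matroid_eq_rmat: "cycle_matroid E ends = rmat"
proof -
  have "(\<exists>C. graph_cycle E ends C \<and> C \<subseteq> X) \<longleftrightarrow> grank X \<noteq> card X" if X: "X \<subseteq> E" for X
  proof
    assume "\<exists>C. graph_cycle E ends C \<and> C \<subseteq> X"
    then obtain C where C: "graph_cycle E ends C" "C \<subseteq> X" by blast
    then obtain e where e: "e \<in> C" by (fastforce simp: graph_cycle_def cycle_traversal_def)
    then obtain a b where "ends e = {a, b}" "conn (C - {e}) a b" using graph_cycle_remove C by blast
    then show "grank X \<noteq> card X"
      using grank_eq_card_iff[OF X] e C conn_mono[of "C - {e}" a b "X - {e}"] by blast
  next
    assume "grank X \<noteq> card X"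
    then show "\<exists>C. graph_cycle E ends C \<and> C \<subseteq> X"
      using grank_eq_card_iff[OF X] graph_cycle_through[OF X] by blast
  qed
  then show ?thesis by (auto simp: cycle_matroid_def rmat_def)
qed

lemma matroid_cycle_matroid: "matroid (cycle_matroid E ends)"
  using matroid_rmat by (simp add: cycle_matroid_eq_rmat)

lemma rk_cycle_matroid: "X \<subseteq> E \<Longrightarrow> rk (cycle_matroid E ends) X = grank X"
  by (simp add: cycle_matroid_eq_rmat rk_rmat)

end

section \<open>Gain graphs\<close>

lemma (in group) conj_eq_one_iff:
  assumes "g \<in> carrier G" "x \<in> carrier G"
  shows "g \<otimes> x \<otimes> inv g = \<one> \<longleftrightarrow> x = \<one>"
proof
  assume "g \<otimes> x \<otimes> inv g = \<one>"
  then have "g \<otimes> x = \<one> \<otimes> g" using assms by (metis inv_solve_right m_closed one_closed)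
  then show "x = \<one>" using assms by simp
qed (use assms in simp)

locale gain_graph = group G for G :: "('a, 'b) monoid_scheme" (structure) +
  fixes n :: nat
  assumes finite_carrier: "finite (carrier G)"
begin

abbreviation EE :: "(nat set \<times> 'a) set" where
  "EE \<equiv> gain_edges n G"

lemma EE_iff: "({i, j}, a) \<in> EE \<longleftrightarrow> i \<in> {1..n} \<and> j \<in> {1..n} \<and> i \<noteq> j \<and> a \<in> carrier G"
  by (auto simp: gain_edges_def card_insert_if)

lemma EE_cases:
  assumes "e \<in> EE"
  obtains i j a where "e = ({i, j}, a)" "i < j" "i \<in> {1..n}" "j \<in> {1..n}" "a \<in> carrier G"
proof -
  obtain i j where ij: "fst e = {i, j}" "i \<noteq> j" "{i, j} \<subseteq> {1..n}" and a: "snd e \<in> carrier G"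
    using assms by (auto simp: gain_edges_def card_2_iff)
  show thesis
  proof (cases "i < j")
    case True
    show ?thesis by (rule that[of i j "snd e"]) (use True ij a in \<open>auto simp: prod_eq_iff\<close>)
  next
    case False
    show ?thesis by (rule that[of j i "snd e"]) (use False ij a in \<open>auto simp: prod_eq_iff\<close>)
  qed
qed

sublocale multigraph EE fst
proof
  have "{e. e \<subseteq> {1..n} \<and> card e = 2} \<subseteq> Pow {1..n}" by auto
  then show "finite EE" unfolding gain_edges_def using finite_carrier finite_subset by blast
  show "\<exists>u v. u \<noteq> v \<and> fst e = {u, v}" if "e \<in> EE" for e
    using that by (rule EE_cases) (metis fst_conv less_irrefl)
qed

lemma ends_neq: "e \<in> EE \<Longrightarrow> fst e = {i, j} \<Longrightarrow> i \<noteq> j"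
  by (erule EE_cases) auto

definition lab :: "nat set \<times> 'a \<Rightarrow> nat \<Rightarrow> nat \<Rightarrow> 'a" where
  "lab e i j = (if i < j then snd e else inv snd e)"

lemma lab_closed [simp]: "e \<in> EE \<Longrightarrow> lab e i j \<in> carrier G"
  by (auto simp: lab_def gain_edges_def)

lemma lab_rev: "e \<in> EE \<Longrightarrow> fst e = {i, j} \<Longrightarrow> lab e j i = inv (lab e i j)"
proof -
  assume e: "e \<in> EE" "fst e = {i, j}"
  then have "snd e \<in> carrier G" "i \<noteq> j" using ends_neq[OF e] by (auto simp: gain_edges_def)
  then show ?thesis by (auto simp: lab_def)
qed

lemma inv_cancel [simp]:
  assumes "x \<in> carrier G" "y \<in> carrier G"
  shows "inv x \<otimes> (x \<otimes> y) = y" "x \<otimes> (inv x \<otimes> y) = y"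
  using assms by (simp_all flip: m_assoc)

text \<open>The second argument after \<open>X\<close> is the gain of the walk. Vertices and edges
  may repeat, so walks can be concatenated and reversed freely, and no simple cycle has to be
  extracted to detect imbalance.\<close>

inductive walk :: "(nat set \<times> 'a) set \<Rightarrow> nat \<Rightarrow> 'a \<Rightarrow> nat \<Rightarrow> bool" for X i where
  walk_refl: "walk X i \<one> i"
| walk_step: "walk X i w j \<Longrightarrow> e \<in> X \<Longrightarrow> fst e = {j, k} \<Longrightarrow> walk X i (w \<otimes> lab e j k) k"

lemma walk_closed: "walk X i w j \<Longrightarrow> X \<subseteq> EE \<Longrightarrow> w \<in> carrier G"
  by (induction rule: walk.induct) auto

lemma walk_trans:
  assumes "walk X j w' k" "walk X i w j" "X \<subseteq> EE"
  shows "walk X i (w \<otimes> w') k"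
  using assms
proof (induction rule: walk.induct)
  case (walk_step w' k e l)
  have "e \<in> EE" using walk_step by auto
  moreover have "walk X i ((w \<otimes> w') \<otimes> lab e k l) l" using walk_step walk.walk_step by blast
  ultimately show ?case
    using walk_closed[OF \<open>walk X i w j\<close>] walk_closed[OF \<open>walk X j w' k\<close>] walk_step
    by (simp add: m_assoc)
qed (use walk_closed in auto)

lemma walk_rev:
  assumes "walk X i w j" "X \<subseteq> EE"
  shows "walk X j (inv w) i"
  using assms
proof (induction rule: walk.induct)
  case (walk_step w j e k)
  have e: "e \<in> EE" using walk_step by auto
  have rev: "lab e k j = inv (lab e j k)" using lab_rev[OF e] walk_step by blast
  have "walk X k (\<one> \<otimes> lab e k j) j"
    by (rule walk.walk_step[OF walk_refl]) (use walk_step in auto)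
  then have "walk X k (lab e k j \<otimes> inv w) i" using walk_trans walk_step e by simp
  then show ?case using walk_closed walk_step e rev by (simp add: inv_mult_group)
qed (simp add: walk_refl)

lemma conn_iff_walk: "conn X i j \<longleftrightarrow> (\<exists>w. walk X i w j)"
proof
  assume "conn X i j"
  then show "\<exists>w. walk X i w j" unfolding conn_def
    by (induction rule: rtranclp_induct) (blast intro: walk_refl walk_step)+
next
  assume "\<exists>w. walk X i w j"
  then obtain w where "walk X i w j" by blast
  then show "conn X i j"
    by (induction rule: walk.induct) (use conn_edge conn_trans in \<open>blast intro: conn_refl\<close>)+
qed

text \<open>
  After switching at every vertex \<open>v\<close> by \<open>\<eta> v\<close>, all labels of edges in \<open>X\<close> lie in \<open>A\<close>.
\<close>

definition pot :: "(nat set \<times> 'a) set \<Rightarrow> 'a set \<Rightarrow> (nat \<Rightarrow> 'a) \<Rightarrow> bool" where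
  "pot X A \<eta> \<longleftrightarrow> range \<eta> \<subseteq> carrier G \<and>
     (\<forall>e\<in>X. \<forall>i j. fst e = {i, j} \<longrightarrow> \<eta> i \<otimes> lab e i j \<otimes> inv \<eta> j \<in> A)"

lemma pot_closed: "pot X A \<eta> \<Longrightarrow> \<eta> v \<in> carrier G"
  by (auto simp: pot_def)

lemma pot_mono: "pot Y A \<eta> \<Longrightarrow> X \<subseteq> Y \<Longrightarrow> A \<subseteq> B \<Longrightarrow> pot X B \<eta>"
  unfolding pot_def by blast

lemma pot_Un: "pot X A \<eta> \<Longrightarrow> pot Y A \<eta> \<Longrightarrow> pot (X \<union> Y) A \<eta>"
  unfolding pot_def by blast

text \<open>\<open>pot\<close> speaks about both directions of an edge; one of them is enough since
  \<open>A\<close> is closed under inverses.\<close>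

lemma pot_single:
  assumes "subgroup A G" "range \<eta> \<subseteq> carrier G" "e \<in> EE" "fst e = {a, b}"
    and "\<eta> a \<otimes> lab e a b \<otimes> inv \<eta> b \<in> A"
  shows "pot {e} A \<eta>"
proof -
  have \<eta>: "\<eta> v \<in> carrier G" for v using assms(2) by auto
  have "inv (\<eta> a \<otimes> lab e a b \<otimes> inv \<eta> b) \<in> A" using assms(1,5) subgroup.m_inv_closed by metis
  then have "\<eta> b \<otimes> lab e b a \<otimes> inv \<eta> a \<in> A"
    using \<eta> assms(3,4) lab_rev by (simp add: inv_mult_group m_assoc)
  then show ?thesis using assms by (auto simp: pot_def doubleton_eq_iff)
qed

lemma pot_insert:
  assumes "pot X A \<eta>" "subgroup A G" "e \<in> EE" "fst e = {a, b}"
    and "\<eta> a \<otimes> lab e a b \<otimes> inv \<eta> b \<in> A"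
  shows "pot (insert e X) A \<eta>"
proof -
  have "pot {e} A \<eta>" by (rule pot_single) (use assms in \<open>auto simp: pot_def\<close>)
  from pot_Un[OF this assms(1)] show ?thesis by simp
qed

lemma pot_walk:
  assumes "walk X i w j" "pot X A \<eta>" "subgroup A G" "X \<subseteq> EE"
  shows "\<eta> i \<otimes> w \<otimes> inv \<eta> j \<in> A"
  using assms
proof (induction rule: walk.induct)
  case walk_refl
  then show ?case using pot_closed subgroup.one_closed by simp
next
  case (walk_step w j e k)
  have "(\<eta> i \<otimes> w \<otimes> inv \<eta> j) \<otimes> (\<eta> j \<otimes> lab e j k \<otimes> inv \<eta> k) \<in> A"
    using walk_step subgroup.m_closed by (metis pot_def)
  moreover have "e \<in> EE" "w \<in> carrier G" "\<And>v. \<eta> v \<in> carrier G"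
    using walk_step walk_closed pot_closed by auto
  ultimately show ?case by (simp add: m_assoc)
qed

text \<open>If every closed walk had trivial gain, then the gain of a walk from the root of its
  component to \<open>v\<close> would depend on \<open>v\<close> alone, and as a potential it would
  switch all labels to \<open>\<one>\<close>.\<close>

lemma unbalanced_walk:
  assumes "\<nexists>\<eta>. pot X {\<one>} \<eta>" "X \<subseteq> EE"
  obtains v w where "walk X v w v" "w \<noteq> \<one>"
proof (rule ccontr)
  note witness = that
  assume "\<not> thesis"
  then have closed: "w = \<one>" if "walk X v w v" for v w using that witness by blast
  define root where "root v = (LEAST u. conn X u v)" for v
  have root: "conn X (root v) v" for v unfolding root_def by (rule LeastI[of "\<lambda>u. conn X u v" v]) simp
  have root_eq: "root u = root v" if "conn X u v" for u v
  proof -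
    have "conn X x u \<longleftrightarrow> conn X x v" for x using that conn_trans conn_sym by meson
    then show ?thesis by (simp add: root_def)
  qed
  define \<eta> where "\<eta> v = (SOME w. walk X (root v) w v)" for v
  have \<eta>: "walk X (root v) (\<eta> v) v" for v
    unfolding \<eta>_def using root conn_iff_walk by (metis someI_ex)
  have "pot X {\<one>} \<eta>"
    unfolding pot_def
  proof (intro conjI ballI allI impI)
    show "range \<eta> \<subseteq> carrier G" using walk_closed[OF \<eta>] assms by auto
    fix e i j assume e: "e \<in> X" "fst e = {i, j}"
    have "root i = root j" using e conn_edge root_eq by blast
    then have "walk X (root i) (\<eta> i \<otimes> lab e i j \<otimes> inv \<eta> j) (root i)"
      using walk_trans[OF walk_rev[OF \<eta>[of j]] walk_step[OF \<eta>[of i] e]] assms by simp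
    then show "\<eta> i \<otimes> lab e i j \<otimes> inv \<eta> j \<in> {\<one>}" using closed by simp
  qed
  then show False using assms by blast
qed

text \<open>Multiplying the potential by \<open>g\<close> on the component of \<open>b\<close> makes
  the switched label of \<open>e\<close> trivial and conjugates all labels in that component by
  \<open>g\<close>. Either \<open>A\<close> tolerates this, or the component has no edges.\<close>

lemma pot_extend:
  assumes "pot X A \<eta>" "subgroup A G" "X \<subseteq> EE" "e \<in> EE" "fst e = {a, b}" "\<not> conn X a b"
    and b: "(\<forall>g\<in>carrier G. \<forall>x\<in>A. g \<otimes> x \<otimes> inv g \<in> A) \<or> (\<forall>f\<in>X. b \<notin> fst f)"
  shows "\<exists>\<eta>'. pot (insert e X) A \<eta>'"
proof -
  have \<eta>: "\<eta> v \<in> carrier G" for v using pot_closed assms by blast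
  define g where "g = \<eta> a \<otimes> lab e a b \<otimes> inv \<eta> b"
  have g: "g \<in> carrier G" using \<eta> assms by (simp add: g_def)
  define \<eta>' where "\<eta>' v = (if conn X b v then g \<otimes> \<eta> v else \<eta> v)" for v
  have \<eta>': "range \<eta>' \<subseteq> carrier G" using \<eta> g by (auto simp: \<eta>'_def)
  have "pot X A \<eta>'"
    unfolding pot_def
  proof (intro conjI ballI allI impI)
    fix f i j assume f: "f \<in> X" "fst f = {i, j}"
    have ij: "conn X b i \<longleftrightarrow> conn X b j" using f conn_edge conn_trans conn_sym by metis
    have *: "\<eta> i \<otimes> lab f i j \<otimes> inv \<eta> j \<in> A" using assms f by (auto simp: pot_def)
    show "\<eta>' i \<otimes> lab f i j \<otimes> inv \<eta>' j \<in> A"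
    proof (cases "conn X b i")
      case True
      have "i = b \<or> (\<exists>e\<in>X. b \<in> fst e)" using conn_imp_incident conn_sym True by metis
      then have "\<exists>e\<in>X. b \<in> fst e" using f by auto
      then have "g \<otimes> (\<eta> i \<otimes> lab f i j \<otimes> inv \<eta> j) \<otimes> inv g \<in> A" using b g * by blast
      moreover have "f \<in> EE" using f assms by auto
      ultimately show ?thesis using True ij \<eta> g by (simp add: \<eta>'_def inv_mult_group m_assoc)
    qed (use * ij in \<open>simp add: \<eta>'_def\<close>)
  qed (rule \<eta>')
  moreover have "\<eta>' a \<otimes> lab e a b \<otimes> inv \<eta>' b = \<one>"
  proof -
    have "\<not> conn X b a" using assms conn_sym by blast
    then have "\<eta>' a \<otimes> lab e a b \<otimes> inv \<eta>' b = g \<otimes> inv g"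
      using \<eta> assms(4) g by (simp add: \<eta>'_def inv_mult_group m_assoc g_def)
    then show ?thesis using g by simp
  qed
  then have "\<eta>' a \<otimes> lab e a b \<otimes> inv \<eta>' b \<in> A" using assms(2) subgroup.one_closed by metis
  ultimately show ?thesis using pot_insert assms by blast
qed

text \<open>The edge \<open>f\<close> followed by a walk in \<open>X\<close> from \<open>b\<close>
  back to \<open>a\<close> is a closed walk, whose gain lies in \<open>B\<close> after switching by
  \<open>\<eta>'\<close>. The difference of the potentials at \<open>a\<close> carries it into
  \<open>A\<close>, and removing the walk, whose gain is in \<open>A\<close> under
  \<open>\<eta>\<close>, leaves the label of \<open>f\<close>.\<close>

lemma pot_transfer:
  assumes "X \<subseteq> EE" "f \<in> EE" "fst f = {a, b}" "conn X a b"
    and "subgroup A G" "subgroup B G" "pot X A \<eta>" "pot (insert f X) B \<eta>'"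
    and conj: "\<And>x. x \<in> B \<Longrightarrow> (\<eta> a \<otimes> inv \<eta>' a) \<otimes> x \<otimes> inv (\<eta> a \<otimes> inv \<eta>' a) \<in> A"
  shows "pot (insert f X) A \<eta>"
proof -
  have \<eta>: "\<eta> v \<in> carrier G" "\<eta>' v \<in> carrier G" for v using pot_closed assms by blast+
  obtain w where w: "walk X a w b" using assms(4) conn_iff_walk by blast
  have wc [simp]: "w \<in> carrier G" using walk_closed w assms(1) by blast
  have A: "\<eta> a \<otimes> w \<otimes> inv \<eta> b \<in> A" using pot_walk[OF w assms(7)] assms by blast
  have "\<eta>' a \<otimes> w \<otimes> inv \<eta>' b \<in> B"
    using pot_walk[OF w pot_mono[OF assms(8)]] assms by blast
  then have "inv (\<eta>' a \<otimes> w \<otimes> inv \<eta>' b) \<in> B" using assms subgroup.m_inv_closed by metis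
  moreover have "\<eta>' a \<otimes> lab f a b \<otimes> inv \<eta>' b \<in> B" using assms by (auto simp: pot_def)
  ultimately have "(\<eta>' a \<otimes> lab f a b \<otimes> inv \<eta>' b) \<otimes> inv (\<eta>' a \<otimes> w \<otimes> inv \<eta>' b) \<in> B"
    using assms subgroup.m_closed by metis
  then have "\<eta>' a \<otimes> lab f a b \<otimes> inv w \<otimes> inv \<eta>' a \<in> B"
    using \<eta> assms(2) by (simp add: inv_mult_group m_assoc)
  from conj[OF this] have "\<eta> a \<otimes> lab f a b \<otimes> inv w \<otimes> inv \<eta> a \<in> A"
    using \<eta> assms(2) by (simp add: inv_mult_group m_assoc)
  then have "(\<eta> a \<otimes> lab f a b \<otimes> inv w \<otimes> inv \<eta> a) \<otimes> (\<eta> a \<otimes> w \<otimes> inv \<eta> b) \<in> A"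
    using A assms subgroup.m_closed by metis
  then have "\<eta> a \<otimes> lab f a b \<otimes> inv \<eta> b \<in> A" using \<eta> assms(2) by (simp add: m_assoc)
  then show ?thesis using pot_insert assms by blast
qed

end

section \<open>A non-elementary lift from a partition\<close>

context gain_graph
begin

section \<open>Balance of cycles in terms of potentials\<close>

definition lprod :: "(nat \<Rightarrow> 'a) \<Rightarrow> nat \<Rightarrow> 'a" where
  "lprod f m = foldr (\<otimes>) (map f [0..<m]) \<one>"

lemma lprod_0 [simp]: "lprod f 0 = \<one>"
  by (simp add: lprod_def)

lemma foldr_closed: "set xs \<subseteq> carrier G \<Longrightarrow> foldr (\<otimes>) xs \<one> \<in> carrier G"
  by (induction xs) auto

lemma foldr_snoc:
  "set xs \<subseteq> carrier G \<Longrightarrow> x \<in> carrier G \<Longrightarrow> foldr (\<otimes>) (xs @ [x]) \<one> = foldr (\<otimes>) xs \<one> \<otimes> x"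
proof (induction xs)
  case (Cons y xs)
  then show ?case using foldr_closed[of xs] by (simp add: m_assoc)
qed simp

lemma lprod_closed: "(\<And>i. i < m \<Longrightarrow> f i \<in> carrier G) \<Longrightarrow> lprod f m \<in> carrier G"
  unfolding lprod_def by (rule foldr_closed) auto

lemma lprod_Suc: "(\<And>i. i < Suc m \<Longrightarrow> f i \<in> carrier G) \<Longrightarrow> lprod f (Suc m) = lprod f m \<otimes> f m"
proof -
  assume "\<And>i. i < Suc m \<Longrightarrow> f i \<in> carrier G"
  then have "set (map f [0..<m]) \<subseteq> carrier G" "f m \<in> carrier G" by auto
  from foldr_snoc[OF this] show ?thesis by (simp add: lprod_def)
qed

lemma lprod_telescope:
  assumes "\<And>i. u i \<in> carrier G" "\<And>i. i < m \<Longrightarrow> f i = inv (u i) \<otimes> u (Suc i)"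
  shows "lprod f m = inv (u 0) \<otimes> u m"
  using assms(2)
proof (induction m)
  case (Suc m)
  have "lprod f (Suc m) = lprod f m \<otimes> f m" by (rule lprod_Suc) (use Suc assms(1) in auto)
  then show ?case using Suc assms(1) by (simp add: m_assoc)
qed (use assms(1) in simp)

text \<open>Under a potential the product of the labels telescopes around the cycle. Conversely, the
  products over initial segments of a traversal form a potential. As a potential does not refer to a
  traversal, this removes the choice made in \<open>balanced\<close>.\<close>

lemma balanced_iff_pot:
  assumes "gain_cycle n G C"
  shows "balanced n G C \<longleftrightarrow> (\<exists>\<eta>. pot C {\<one>} \<eta>)"
proof -
  define step where "step = (\<lambda>vs es i. lab (es ! i) (vs ! i) (vs ! (Suc i mod length es)))"
  have gain: "traversal_gain G vs es = lprod (step vs es) (length es)" for vs es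
    by (simp add: traversal_gain_def lprod_def step_def lab_def)
  show ?thesis
  proof
    assume "\<exists>\<eta>. pot C {\<one>} \<eta>"
    then obtain \<eta> where \<eta>: "pot C {\<one>} \<eta>" by blast
    obtain vs es where t: "cycle_traversal EE fst vs es" "C = set es"
      using assms by (auto simp: graph_cycle_def)
    let ?u = "\<lambda>i. \<eta> (vs ! (i mod length es))"
    have "lprod (step vs es) (length es) = inv (?u 0) \<otimes> ?u (length es)"
    proof (rule lprod_telescope)
      show u: "?u i \<in> carrier G" for i using pot_closed[OF \<eta>] by simp
      fix i assume i: "i < length es"
      then have e: "es ! i \<in> C" "es ! i \<in> EE" "fst (es ! i) = {vs ! i, vs ! (Suc i mod length es)}"
        using t by (auto simp: cycle_traversal_def)
      then have "?u i \<otimes> step vs es i \<otimes> inv (?u (Suc i)) = \<one>"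
        using \<eta> i by (auto simp: pot_def step_def)
      then have "inv (?u i) \<otimes> (?u i \<otimes> step vs es i \<otimes> inv (?u (Suc i))) \<otimes> ?u (Suc i)
        = inv (?u i) \<otimes> ?u (Suc i)"
        using u by simp
      then show "step vs es i = inv (?u i) \<otimes> ?u (Suc i)"
        using u e(2) i pot_closed[OF \<eta>] by (simp add: m_assoc step_def)
    qed
    then have "traversal_gain G vs es = \<one>" using pot_closed[OF \<eta>] by (simp add: gain)
    then show "balanced n G C" using t unfolding balanced_def by blast
  next
    assume "balanced n G C"
    then obtain vs es where t: "cycle_traversal EE fst vs es" "C = set es"
      and one: "lprod (step vs es) (length es) = \<one>"
      by (auto simp: balanced_def gain)
    let ?l = "length es" and ?P = "lprod (step vs es)"
    have l: "length vs = ?l" "distinct vs" "set es \<subseteq> EE"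
      and ends: "\<And>i. i < ?l \<Longrightarrow> fst (es ! i) = {vs ! i, vs ! (Suc i mod ?l)}"
      using t by (auto simp: cycle_traversal_def)
    have step: "step vs es i \<in> carrier G" if "i < ?l" for i
      unfolding step_def by (rule lab_closed) (use that l in auto)
    have P: "?P i \<in> carrier G" if "i \<le> ?l" for i
      by (rule lprod_closed) (use that step in auto)
    define \<eta> where "\<eta> v = (if v \<in> set vs then ?P (THE k. k < ?l \<and> vs ! k = v) else \<one>)" for v
    have \<eta>: "\<eta> (vs ! k) = ?P k" if "k < ?l" for k
    proof -
      have "(THE j. j < ?l \<and> vs ! j = vs ! k) = k"
        by (rule the_equality) (use that l in \<open>auto simp: nth_eq_iff_index_eq\<close>)
      then show ?thesis using that l by (simp add: \<eta>_def)
    qed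
    have "\<eta> v \<in> carrier G" for v
    proof (cases "v \<in> set vs")
      case True
      then obtain k where "k < ?l" "v = vs ! k" using l by (auto simp: in_set_conv_nth)
      then show ?thesis using \<eta> P by simp
    qed (simp add: \<eta>_def)
    then have range: "range \<eta> \<subseteq> carrier G" by auto
    have "pot {e} {\<one>} \<eta>" if "e \<in> C" for e
    proof -
      obtain k where k: "k < ?l" "e = es ! k" using \<open>e \<in> C\<close> t by (auto simp: in_set_conv_nth)
      \<comment> \<open>At the closing edge the index returns to 0; the two values agree there
        because the whole product is \<open>\<one>\<close>, the empty product.\<close>
      have "?P (Suc k) = ?P (Suc k mod ?l)" using k one by (cases "Suc k = ?l") auto
      moreover have "Suc k mod ?l < ?l" by (rule mod_less_divisor) (use k in linarith)
      ultimately have "\<eta> (vs ! (Suc k mod ?l)) = ?P k \<otimes> step vs es k"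
        using lprod_Suc[of k "step vs es"] step k \<eta> by simp
      then have "\<eta> (vs ! k) \<otimes> lab e (vs ! k) (vs ! (Suc k mod ?l)) \<otimes> inv \<eta> (vs ! (Suc k mod ?l)) \<in> {\<one>}"
        using \<eta>[of k] k P[of k] step[of k] by (simp add: step_def)
      moreover have "e \<in> EE" using k l by auto
      ultimately show ?thesis
        using pot_single[OF triv_subgroup range] ends k by blast
    qed
    then have "pot C {\<one>} \<eta>" using range by (auto simp: pot_def)
    then show "\<exists>\<eta>. pot C {\<one>} \<eta>" by blast
  qed
qed

end

text \<open>The members of \<open>H\<close> stand for the parts with the identity adjoined.
  Conjugation may permute them, since two potentials for the same edges can differ by a group
  element at a vertex, which conjugates the subgroup. \<open>three_or_normal\<close> enters where an
  edge joins two components, or where the imbalance sits in another component than the edge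
  considered.\<close>

locale partitioned_gain_graph = gain_graph G n for G :: "('a, 'b) monoid_scheme" (structure) and n +
  fixes H :: "'a set set"
  assumes H_subgroup: "A \<in> H \<Longrightarrow> subgroup A G"
    and H_proper: "A \<in> H \<Longrightarrow> A \<noteq> carrier G"
    and H_cover: "x \<in> carrier G \<Longrightarrow> \<exists>A\<in>H. x \<in> A"
    and H_disjoint: "A \<in> H \<Longrightarrow> B \<in> H \<Longrightarrow> x \<in> A \<Longrightarrow> x \<in> B \<Longrightarrow> x \<noteq> \<one> \<Longrightarrow> A = B"
    and H_conj: "A \<in> H \<Longrightarrow> g \<in> carrier G \<Longrightarrow> (\<lambda>x. g \<otimes> x \<otimes> inv g) ` A \<in> H"
    and three_or_normal: "n = 3 \<or> (\<forall>A\<in>H. \<forall>g\<in>carrier G. \<forall>x\<in>A. g \<otimes> x \<otimes> inv g \<in> A)"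
    and two_le: "2 \<le> n"
begin

section \<open>The rank function of the lift\<close>

abbreviation bal :: "(nat set \<times> 'a) set \<Rightarrow> bool" where
  "bal X \<equiv> \<exists>\<eta>. pot X {\<one>} \<eta>"

abbreviation hbal :: "(nat set \<times> 'a) set \<Rightarrow> bool" where
  "hbal X \<equiv> \<exists>A\<in>H. \<exists>\<eta>. pot X A \<eta>"

definition excess :: "(nat set \<times> 'a) set \<Rightarrow> nat" where
  "excess X = (if bal X then 0 else if hbal X then 1 else 2)"

definition lrank :: "(nat set \<times> 'a) set \<Rightarrow> nat" where
  "lrank X = grank X + excess X"

lemma bal_imp_hbal:
  assumes "bal X"
  shows "hbal X"
proof -
  obtain A where "A \<in> H" using H_cover by blast
  then show ?thesis using assms pot_mono[of X "{\<one>}" _ X A] subgroup.one_closed[OF H_subgroup] by blast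
qed

lemma bal_mono: "bal Y \<Longrightarrow> X \<subseteq> Y \<Longrightarrow> bal X"
  and hbal_mono: "hbal Y \<Longrightarrow> X \<subseteq> Y \<Longrightarrow> hbal X"
  using pot_mono by blast+

lemma excess_0_iff: "excess X = 0 \<longleftrightarrow> bal X"
  by (simp add: excess_def)

lemma excess_le_1_iff: "excess X \<le> 1 \<longleftrightarrow> hbal X"
  using bal_imp_hbal[of X] by (simp add: excess_def)

lemma excess_le_2: "excess X \<le> 2"
  by (simp add: excess_def)

lemma excess_mono:
  assumes "X \<subseteq> Y"
  shows "excess X \<le> excess Y"
proof -
  have "excess Y = 0 \<Longrightarrow> excess X = 0" using bal_mono[OF _ assms] by (simp only: excess_0_iff)
  moreover have "excess Y \<le> 1 \<Longrightarrow> excess X \<le> 1"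
    using hbal_mono[OF _ assms] by (simp only: excess_le_1_iff)
  ultimately show ?thesis using excess_le_2[of X] by linarith
qed

text \<open>Once \<open>X\<close> is switched to trivial labels, only \<open>e\<close> carries a
  label, and some member of \<open>H\<close> contains it. So one edge never lifts the excess from 0
  to 2.\<close>

lemma bal_insert_hbal:
  assumes "bal X" "e \<in> EE"
  shows "hbal (insert e X)"
proof -
  obtain \<eta> where \<eta>: "pot X {\<one>} \<eta>" using assms by blast
  obtain a b where ab: "fst e = {a, b}" using assms ends_E by blast
  have "\<eta> a \<otimes> lab e a b \<otimes> inv \<eta> b \<in> carrier G" using pot_closed[OF \<eta>] assms by simp
  then obtain A where A: "A \<in> H" "\<eta> a \<otimes> lab e a b \<otimes> inv \<eta> b \<in> A" using H_cover by blast
  have "pot X A \<eta>"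
    using pot_mono[OF \<eta>, of X A] subgroup.one_closed[OF H_subgroup[OF A(1)]] by blast
  then show ?thesis using pot_insert H_subgroup A assms ab by blast
qed

lemma excess_insert_le:
  assumes "e \<in> EE"
  shows "excess (insert e X) \<le> Suc (excess X)"
proof -
  have "excess X = 0 \<Longrightarrow> excess (insert e X) \<le> 1"
    using bal_insert_hbal[OF _ assms] by (simp only: excess_0_iff excess_le_1_iff)
  then show ?thesis using excess_le_2[of "insert e X"] by linarith
qed

lemma incident_ends:
  assumes "f \<in> EE" "b \<in> fst f"
  shows "\<exists>k. fst f = {b, k}"
  using ends_E[OF assms(1)] assms(2) by auto

text \<open>
  For three vertices one end of a bridge is isolated, so it can be switched freely;
  otherwise a whole component is switched, which needs \<open>A\<close> to be normal.
\<close>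

lemma pot_insert_bridge:
  assumes "X \<subseteq> EE" "e \<in> EE" "fst e = {a, b}" "\<not> conn X a b" "A \<in> H \<or> A = {\<one>}" "pot X A \<eta>"
  shows "\<exists>\<eta>'. pot (insert e X) A \<eta>'"
proof -
  have A: "subgroup A G" using assms(5) H_subgroup triv_subgroup by blast
  consider "\<forall>g\<in>carrier G. \<forall>x\<in>A. g \<otimes> x \<otimes> inv g \<in> A" | "\<forall>f\<in>X. b \<notin> fst f" | "\<forall>f\<in>X. a \<notin> fst f"
  \<comment> \<open>The trivial subgroup is invariant under conjugation for every \<open>n\<close>,
    so the count of vertices matters only for members of \<open>H\<close>: edges at both ends of the
    bridge would have other ends in different components, four vertices in all.\<close>
  proof (cases "A \<in> H \<and> n = 3")
    case True
    have False if ff: "f \<in> X" "b \<in> fst f" "f' \<in> X" "a \<in> fst f'" for f f'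
    proof -
      obtain k l where k: "fst f = {b, k}" and l: "fst f' = {a, l}"
        using ff assms(1) incident_ends by (metis subsetD)
      have E: "f \<in> EE" "f' \<in> EE" using ff assms(1) by auto
      have "conn X b k" "conn X a l" using k l ff conn_edge by blast+
      then have "k \<noteq> a" "l \<noteq> b" "k \<noteq> l" using assms(4) conn_sym conn_trans by blast+
      moreover have "k \<noteq> b" "l \<noteq> a" "a \<noteq> b" using ends_neq[OF E(1) k] ends_neq[OF E(2) l] ends_neq[OF assms(2,3)] by auto
      moreover have "{a, b, k, l} \<subseteq> {1..3}" using E k l True by (auto simp: gain_edges_def)
      ultimately have "card {a, b, k, l} \<le> 3" "card {a, b, k, l} = 4"
        using card_mono[of "{1..3::nat}" "{a, b, k, l}"] by auto
      then show False by simp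
    qed
    then show ?thesis using that(2,3) by blast
  next
    case False
    then show ?thesis using that(1) three_or_normal assms(5) by auto
  qed
  then show ?thesis
  proof cases
    case 3
    have "\<not> conn X b a" "fst e = {b, a}" using assms conn_sym by (auto simp: insert_commute)
    then show ?thesis using pot_extend[OF assms(6) A assms(1,2), of b a] 3 by blast
  qed (use pot_extend[OF assms(6) A assms(1-4)] in blast)+
qed

lemma excess_insert_bridge:
  assumes "X \<subseteq> EE" "e \<in> EE" "fst e = {a, b}" "\<not> conn X a b"
  shows "excess (insert e X) = excess X"
proof -
  have "bal (insert e X) \<longleftrightarrow> bal X"
    using pot_insert_bridge[OF assms, of "{\<one>}"] bal_mono[of "insert e X" X] by blast
  moreover have "hbal (insert e X) \<longleftrightarrow> hbal X"
    using pot_insert_bridge[OF assms] hbal_mono[of "insert e X" X] by blast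
  ultimately show ?thesis by (simp only: excess_def)
qed

text \<open>The conjugate of \<open>B\<close> by \<open>g\<close> is again a member of
  \<open>H\<close>. It shares a nontrivial element with \<open>A\<close>, hence it is
  \<open>A\<close>.\<close>

lemma H_conj_subset:
  assumes "A \<in> H" "B \<in> H" "x \<in> B" "x \<noteq> \<one>" "g \<in> carrier G" "g \<otimes> x \<otimes> inv g \<in> A" "y \<in> B"
  shows "g \<otimes> y \<otimes> inv g \<in> A"
proof -
  have x: "x \<in> carrier G" using assms H_subgroup subgroup.mem_carrier by metis
  have "g \<otimes> x \<otimes> inv g \<noteq> \<one>" using conj_eq_one_iff assms(4,5) x by blast
  then have "(\<lambda>x. g \<otimes> x \<otimes> inv g) ` B = A"
    using H_disjoint[OF H_conj[OF assms(2,5)] assms(1)] assms(3,6) by blast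
  then show ?thesis using assms(7) by blast
qed

text \<open>
  An unbalanced closed walk determines the class \<open>A\<close>, up to the conjugation by the
  difference of the two potentials.
\<close>

lemma pot_transfer_unbalanced:
  assumes "X \<subseteq> EE" "f \<in> EE" "fst f = {a, b}" "conn X a b" "\<not> bal X"
    and "A \<in> H" "B \<in> H" "pot X A \<eta>" "pot (insert f X) B \<eta>'"
  shows "pot (insert f X) A \<eta>"
proof (rule pot_transfer[OF assms(1-4) _ _ assms(8,9)])
  show A: "subgroup A G" and B: "subgroup B G" using H_subgroup assms by auto
  have \<eta>: "\<eta> v \<in> carrier G" "\<eta>' v \<in> carrier G" for v using pot_closed assms by blast+
  obtain v w where vw: "walk X v w v" "w \<noteq> \<one>" using unbalanced_walk[OF assms(5,1)] by blast
  have w: "w \<in> carrier G" using walk_closed vw assms by blast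
  have potB: "pot X B \<eta>'" using pot_mono[OF assms(9)] by blast
  have mem: "\<eta> u \<otimes> z \<otimes> inv \<eta> u \<in> A" "\<eta>' u \<otimes> z \<otimes> inv \<eta>' u \<in> B" if "walk X u z u" for u z
    using pot_walk[OF that assms(8) A assms(1)] pot_walk[OF that potB B assms(1)] .
  fix x assume x: "x \<in> B"
  show "\<eta> a \<otimes> inv \<eta>' a \<otimes> x \<otimes> inv (\<eta> a \<otimes> inv \<eta>' a) \<in> A"
  proof (cases "conn X a v")
    case True
    then obtain u where u: "walk X a u v" using conn_iff_walk by blast
    \<comment> \<open>The unbalanced closed walk is carried from \<open>v\<close> to
      \<open>a\<close> along a walk with gain \<open>u\<close>. Its gain stays nontrivial, so it
      shows at \<open>a\<close> which conjugate of \<open>B\<close> is \<open>A\<close>.\<close>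
    let ?z = "u \<otimes> w \<otimes> inv u"
    have uc: "u \<in> carrier G" using walk_closed u assms by blast
    have z: "walk X a ?z a"
      using walk_trans[OF walk_rev[OF u assms(1)] walk_trans[OF vw(1) u assms(1)] assms(1)] .
    have zc: "?z \<in> carrier G" "?z \<noteq> \<one>" using uc w conj_eq_one_iff vw by auto
    show ?thesis
    proof (rule H_conj_subset[OF assms(6,7) mem(2)[OF z] _ _ _ x])
      show "\<eta> a \<otimes> inv \<eta>' a \<otimes> (\<eta>' a \<otimes> ?z \<otimes> inv \<eta>' a) \<otimes> inv (\<eta> a \<otimes> inv \<eta>' a) \<in> A"
        using mem(1)[OF z] \<eta> zc(1) uc w by (simp add: m_assoc inv_mult_group)
    qed (use \<eta> zc conj_eq_one_iff in auto)
  next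
    case False
    \<comment> \<open>The component of \<open>v\<close> contains an edge, and so it has two vertices
      outside the component of \<open>a\<close> and \<open>b\<close>.\<close>
    have "n \<noteq> 3"
    proof
      assume "n = 3"
      have "\<exists>e\<in>X. v \<in> fst e"
        using vw by (cases rule: walk.cases) auto
      then obtain e where e: "e \<in> X" "v \<in> fst e" by blast
      then obtain k where k: "fst e = {v, k}" using assms(1) incident_ends by blast
      have E: "e \<in> EE" using e assms by auto
      have vk: "conn X v k" using e k conn_edge by blast
      then have "v \<noteq> a" "v \<noteq> b" "k \<noteq> a" "k \<noteq> b" using False assms(4) conn_sym conn_trans by blast+
      moreover have "v \<noteq> k" "a \<noteq> b" using ends_neq[OF E k] ends_neq[OF assms(2,3)] by auto
      moreover have "{a, b, v, k} \<subseteq> {1..3}" using E k assms(2,3) \<open>n = 3\<close> by (auto simp: gain_edges_def)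
      ultimately have "card {a, b, v, k} \<le> 3" "card {a, b, v, k} = 4"
        using card_mono[of "{1..3::nat}" "{a, b, v, k}"] by auto
      then show False by simp
    qed
    then have normal: "\<And>C g x. C \<in> H \<Longrightarrow> g \<in> carrier G \<Longrightarrow> x \<in> C \<Longrightarrow> g \<otimes> x \<otimes> inv g \<in> C"
      using three_or_normal by blast
    have "inv \<eta> v \<otimes> (\<eta> v \<otimes> w \<otimes> inv \<eta> v) \<otimes> inv (inv \<eta> v) \<in> A"
      "inv \<eta>' v \<otimes> (\<eta>' v \<otimes> w \<otimes> inv \<eta>' v) \<otimes> inv (inv \<eta>' v) \<in> B"
      using normal[OF assms(6) inv_closed[OF \<eta>(1)] mem(1)[OF vw(1)]]
        normal[OF assms(7) inv_closed[OF \<eta>(2)] mem(2)[OF vw(1)]] .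
    then have "w \<in> A" "w \<in> B" using \<eta> w by (auto simp: m_assoc)
    then have "A = B" using H_disjoint assms vw by blast
    then show ?thesis using normal[OF assms(7) _ x] \<eta> by auto
  qed
qed

text \<open>One edge cannot raise both summands, because a bridge leaves the excess alone. As both
  summands are monotone, an unchanged sum means that neither changed. Then the ends of
  \<open>f\<close> are connected in \<open>X\<close>, and a potential for \<open>insert e X\<close>
  also serves \<open>insert f X\<close>, so that the two sets can be merged; excess 2 is the maximum
  anyway.\<close>

lemma rank_function_lrank: "rank_function EE lrank"
proof
  have "pot {} {\<one>} (\<lambda>_. \<one>)" by (auto simp: pot_def)
  then show "lrank {} = 0" using r_empty by (auto simp: lrank_def excess_def)
next
  fix X e assume X: "X \<subseteq> EE" "e \<in> EE"
  show "lrank X \<le> lrank (insert e X)"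
    using r_insert_mono[OF X] excess_mono[of X "insert e X"] by (simp add: lrank_def add_mono subset_insertI)
  obtain a b where ab: "fst e = {a, b}" using ends_E X by blast
  show "lrank (insert e X) \<le> Suc (lrank X)"
    using grank_insert_conn[OF ab, of X] grank_insert_not_conn[OF X ab] excess_insert_le[OF X(2), of X]
      excess_insert_bridge[OF X ab] by (cases "conn X a b") (auto simp: lrank_def)
next
  fix X e f assume X: "X \<subseteq> EE" "e \<in> EE" "f \<in> EE"
    and e: "lrank (insert e X) = lrank X" and f: "lrank (insert f X) = lrank X"
  let ?Y = "insert e (insert f X)"
  have *: "grank (insert g X) = grank X" "excess (insert g X) = excess X"
    if "g \<in> EE" "lrank (insert g X) = lrank X" for g
    using r_insert_mono[OF X(1) that(1)] excess_mono[of X "insert g X"] that(2)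
    by (auto simp: lrank_def subset_insertI)
  have ge: "grank (insert e X) = grank X" "excess (insert e X) = excess X"
    and gf: "grank (insert f X) = grank X" "excess (insert f X) = excess X"
    using *[OF X(2) e] *[OF X(3) f] by auto
  have "grank ?Y = grank X" using r_local[OF X ge(1) gf(1)] .
  moreover have "excess ?Y = excess X"
  proof -
    obtain a b where ab: "fst f = {a, b}" using ends_E X by blast
    have conn: "conn X a b" using grank_insert_eq_iff[OF X(1,3) ab] gf by simp
    have Y: "?Y = insert e X \<union> insert f X" by auto
    have le: "excess X \<le> excess ?Y" by (rule excess_mono) auto
    consider "bal X" | "\<not> bal X" "hbal X" | "\<not> bal X" "\<not> hbal X" by blast
    then show ?thesis
    proof cases
      case 1
      then have "bal (insert e X)" "bal (insert f X)" using ge(2) gf(2) excess_0_iff by metis+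
      then obtain \<eta> \<eta>' where \<eta>: "pot (insert e X) {\<one>} \<eta>" "pot (insert f X) {\<one>} \<eta>'" by blast
      have "pot (insert f X) {\<one>} \<eta>"
      proof (rule pot_transfer[OF X(1,3) ab conn triv_subgroup triv_subgroup _ \<eta>(2)])
        show "pot X {\<one>} \<eta>" using pot_mono[OF \<eta>(1)] by blast
      qed (use pot_closed[OF \<eta>(1)] pot_closed[OF \<eta>(2)] in simp)
      then have "bal ?Y" using pot_Un[OF \<eta>(1)] Y by metis
      then have "excess ?Y = 0" by (simp only: excess_0_iff)
      then show ?thesis using le by simp
    next
      case 2
      then have "hbal (insert e X)" "hbal (insert f X)" using ge(2) gf(2) excess_le_1_iff by metis+
      then obtain A B \<eta> \<eta>' where AB: "A \<in> H" "B \<in> H"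
        and \<eta>: "pot (insert e X) A \<eta>" "pot (insert f X) B \<eta>'" by blast
      have "pot (insert f X) A \<eta>"
        using pot_transfer_unbalanced[OF X(1,3) ab conn 2(1) AB _ \<eta>(2)] pot_mono[OF \<eta>(1)] by blast
      then have "hbal ?Y" using pot_Un[OF \<eta>(1)] Y AB by metis
      then have "excess ?Y \<le> 1" by (simp only: excess_le_1_iff)
      moreover have "excess X \<noteq> 0" using 2(1) by (simp only: excess_0_iff not_False_eq_True)
      ultimately show ?thesis using le by simp
    next
      case 3
      then have "\<not> excess X \<le> 1" by (simp only: excess_le_1_iff not_False_eq_True)
      then show ?thesis using le excess_le_2[of ?Y] by simp
    qed
  qed
  ultimately show "lrank ?Y = lrank X" by (simp add: lrank_def)
qed (rule finite_edges)

sublocale lift: rank_function EE lrank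
  by (rule rank_function_lrank)

text \<open>A cycle without one of its edges is independent in the graph, hence in the lift. The
  whole cycle has graphic rank one below its size, so it is dependent in the lift exactly if its
  excess is 0.\<close>

lemma gain_lift_in_gain_lifts: "lift.rmat \<in> gain_lifts n G"
proof -
  let ?M = "gain_cycle_matroid n G"
  have ground: "ground ?M = EE" by (simp add: cycle_matroid_def)
  have "is_lift lift.rmat ?M"
  proof (rule is_liftI[OF lift.matroid_rmat matroid_cycle_matroid])
    fix X Y assume XY: "X \<subseteq> Y" "Y \<subseteq> ground ?M"
    then have "X \<subseteq> EE" "Y \<subseteq> EE" using ground by auto
    then show "rk lift.rmat X + rk ?M Y \<le> rk lift.rmat Y + rk ?M X"
      using excess_mono[OF XY(1)] by (simp add: lift.rk_rmat rk_cycle_matroid lrank_def)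
  qed (simp add: ground)
  moreover have "circuit lift.rmat C \<longleftrightarrow> balanced n G C" if C: "gain_cycle n G C" for C
  proof -
    have "C \<subseteq> EE" using C by (auto simp: graph_cycle_def cycle_traversal_def)
    have "C \<noteq> {}" using C by (auto simp: graph_cycle_def cycle_traversal_def)
    then obtain e where e: "e \<in> C" by blast
    obtain a b where ab: "fst e = {a, b}" "conn (C - {e}) a b" using graph_cycle_remove(2)[OF C e] by (elim exE conjE) (rule that)
    have cardC: "card C = Suc (card (C - {e}))"
      using card_Suc_Diff1[OF finite_sub[OF \<open>C \<subseteq> EE\<close>] e] by simp
    have rankC: "grank C = card (C - {e})"
      using grank_insert_conn[OF ab] graph_cycle_remove(1)[OF C e] e by (simp add: insert_absorb)
    have proper: "X \<in> indep lift.rmat" if XC: "X \<subset> C" for X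
    proof -
      obtain g where g: "g \<in> C" "X \<subseteq> C - {g}" using XC by blast
      have D: "C - {g} \<subseteq> EE" using \<open>C \<subseteq> EE\<close> by blast
      have "lrank (C - {g}) = card (C - {g})"
        using graph_cycle_remove(1)[OF C g(1)] lift.r_le_card[OF D] by (simp add: lrank_def)
      then have "C - {g} \<in> indep lift.rmat" using D lift.indep_rmat by blast
      then show ?thesis using g matroid.indep_subset[OF lift.matroid_rmat] by blast
    qed
    have "C \<in> indep lift.rmat \<longleftrightarrow> excess C \<noteq> 0"
      using lift.r_le_card[OF \<open>C \<subseteq> EE\<close>] rankC cardC \<open>C \<subseteq> EE\<close>
      by (auto simp: lift.indep_rmat lrank_def)
    then have "C \<in> indep lift.rmat \<longleftrightarrow> \<not> bal C" by (simp only: excess_0_iff)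
    then show ?thesis using balanced_iff_pot[OF C] proper \<open>C \<subseteq> EE\<close> by (auto simp: circuit_def)
  qed
  ultimately show ?thesis by (simp add: gain_lifts_def)
qed

lemma gain_lift_rank: "matroid_rank lift.rmat \<ge> matroid_rank (gain_cycle_matroid n G) + 2"
proof -
  have "\<not> hbal EE"
  proof
    assume "hbal EE"
    then obtain A \<eta> where A: "A \<in> H" "pot EE A \<eta>" by blast
    have \<eta>: "\<eta> v \<in> carrier G" for v using pot_closed A by blast
    have "x \<in> A" if x: "x \<in> carrier G" for x
    proof -
      \<comment> \<open>The label is chosen so that switching by \<open>\<eta>\<close> turns it into
        \<open>x\<close>: the edges between 1 and 2 alone produce every group element.\<close>
      let ?e = "({1, 2}, inv \<eta> 1 \<otimes> x \<otimes> \<eta> 2)"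
      have "?e \<in> EE" using two_le x \<eta> by (simp add: EE_iff)
      then have "\<eta> 1 \<otimes> lab ?e 1 2 \<otimes> inv \<eta> 2 \<in> A" using A(2) by (auto simp: pot_def)
      then show ?thesis using x \<eta> by (simp add: lab_def m_assoc)
    qed
    then show False using H_proper[OF A(1)] subgroup.subset[OF H_subgroup[OF A(1)]] by blast
  qed
  then have "\<not> excess EE \<le> 1" by (simp only: excess_le_1_iff not_False_eq_True)
  then have "excess EE = 2" using excess_le_2[of EE] by simp
  moreover have "ground (gain_cycle_matroid n G) = EE" by (simp add: cycle_matroid_def)
  ultimately show ?thesis
    by (simp add: matroid.matroid_rank_eq_rk lift.matroid_rmat matroid_cycle_matroid
        lift.rk_rmat rk_cycle_matroid lrank_def)
qed

end

section \<open>A partition from a non-elementary lift\<close>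

lemma (in matroid) circuit_clos:
  assumes "circuit M C" "e \<in> C"
  shows "e \<in> clos M (C - {e})"
proof -
  have C: "C \<subseteq> ground M" "C \<notin> indep M" "C - {e} \<in> indep M"
    using assms by (auto simp: circuit_def)
  then have fin: "finite C" using finite_ground finite_subset by blast
  then have "rk M C < card C" using C indep_iff_rk rk_le_card by (metis le_neq_implies_less)
  moreover have "rk M (C - {e}) = card (C - {e})" using C rk_indep by blast
  ultimately have "rk M C = rk M (C - {e})"
    using rk_mono[of "C - {e}" C] fin assms(2) by (simp add: card_Diff_singleton)
  then show ?thesis using assms(2) by (simp add: clos_def insert_absorb)
qed

lemma (in matroid) clos_closed: "C \<subseteq> clos M X \<Longrightarrow> e \<in> clos M C \<Longrightarrow> e \<in> clos M X"
  using clos_trans by blast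

context gain_graph
begin

lemma triangle_cycle:
  assumes "1 \<le> i" "i < j" "j < k" "k \<le> n" "a \<in> carrier G" "b \<in> carrier G"
  shows "gain_cycle n G {({i, j}, a), ({j, k}, b), ({i, k}, a \<otimes> b)}" (is "gain_cycle n G ?C")
    and "balanced n G {({i, j}, a), ({j, k}, b), ({i, k}, a \<otimes> b)}"
proof -
  have t: "cycle_traversal EE fst [i, j, k] [({i, j}, a), ({j, k}, b), ({i, k}, a \<otimes> b)]"
    using assms unfolding cycle_traversal_def
    by (auto simp: EE_iff less_Suc_eq doubleton_eq_iff)
  then show "gain_cycle n G ?C" unfolding graph_cycle_def by force
  have "traversal_gain G [i, j, k] [({i, j}, a), ({j, k}, b), ({i, k}, a \<otimes> b)] = \<one>"
    using assms by (simp add: traversal_gain_def inv_mult_group m_assoc)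
  then show "balanced n G ?C" using t unfolding balanced_def by force
qed

lemma digon_cycle:
  assumes "1 \<le> i" "i < j" "j \<le> n" "a \<in> carrier G" "b \<in> carrier G" "a \<noteq> b"
  shows "gain_cycle n G {({i, j}, a), ({i, j}, b)}" (is "gain_cycle n G ?C")
    and "\<not> balanced n G {({i, j}, a), ({i, j}, b)}"
proof -
  have "cycle_traversal EE fst [i, j] [({i, j}, a), ({i, j}, b)]"
    using assms unfolding cycle_traversal_def
    by (auto simp: EE_iff less_Suc_eq)
  then show cyc: "gain_cycle n G ?C" unfolding graph_cycle_def by force
  show "\<not> balanced n G ?C"
  proof
    assume "balanced n G ?C"
    \<comment> \<open>Failure of \<open>balanced\<close> concerns all traversals at once. A
      potential would give both parallel edges the same switched label, which settles them
      together.\<close>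
    then obtain \<eta> where \<eta>: "pot ?C {\<one>} \<eta>" using balanced_iff_pot[OF cyc] by blast
    then have *: "\<eta> i \<otimes> lab ({i, j}, x) i j \<otimes> inv \<eta> j = \<one>" if "x = a \<or> x = b" for x
      using that by (auto simp: pot_def)
    have c: "\<eta> v \<in> carrier G" for v using pot_closed[OF \<eta>] .
    have "\<eta> i \<otimes> a \<otimes> inv \<eta> j = \<eta> i \<otimes> b \<otimes> inv \<eta> j"
      using *[of a] *[of b] assms(2) by (simp add: lab_def)
    then show False using c assms by simp
  qed
qed

end

locale gain_graph_lift = gain_graph G n for G :: "('a, 'b) monoid_scheme" (structure) and n +
  fixes L :: "(nat set \<times> 'a) indep_system"
  assumes L: "L \<in> gain_lifts n G"
    and three_le: "3 \<le> n"
    and excess_rank: "matroid_rank L \<ge> matroid_rank (gain_cycle_matroid n G) + 2"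
begin

lemma lift: "is_lift L (gain_cycle_matroid n G)"
  and circuit_iff: "gain_cycle n G C \<Longrightarrow> circuit L C \<longleftrightarrow> balanced n G C"
  using L by (auto simp: gain_lifts_def)

sublocale L: matroid L
  using lift by (simp add: is_lift_def)

lemma ground_L: "ground L = EE"
  using lift by (simp add: is_lift_def cycle_matroid_def)

lemma lift_rank_le: "X \<subseteq> Y \<Longrightarrow> Y \<subseteq> EE \<Longrightarrow> rk L X + grank Y \<le> rk L Y + grank X"
  using is_lift_rk_le[OF lift, of X Y] rk_cycle_matroid[of X] rk_cycle_matroid[of Y]
  by (auto simp: cycle_matroid_def)

lemma grank_le_rk: "X \<subseteq> EE \<Longrightarrow> grank X \<le> rk L X"
  using lift_rank_le[of "{}" X] r_empty by simp

section \<open>Closures in the lift and balanced triangles\<close>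

abbreviation cl :: "(nat set \<times> 'a) set \<Rightarrow> (nat set \<times> 'a) set" where
  "cl \<equiv> clos L"

lemma in_clos: "e \<in> X \<Longrightarrow> e \<in> cl X"
  using L.clos_increasing by blast

lemma triangle_clos:
  assumes "1 \<le> i" "i < j" "j < k" "k \<le> n" "a \<in> carrier G" "b \<in> carrier G"
    and "e \<in> {({i, j}, a), ({j, k}, b), ({i, k}, a \<otimes> b)}"
    and "{({i, j}, a), ({j, k}, b), ({i, k}, a \<otimes> b)} - {e} \<subseteq> cl X"
  shows "e \<in> cl X"
proof -
  let ?C = "{({i, j}, a), ({j, k}, b), ({i, k}, a \<otimes> b)}"
  have "circuit L ?C" using triangle_cycle[OF assms(1-6)] circuit_iff by blast
  from L.clos_closed[OF assms(8) L.circuit_clos[OF this assms(7)]] show ?thesis .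
qed

lemma triangle_ik:
  assumes "1 \<le> i" "i < j" "j < k" "k \<le> n" "a \<in> carrier G" "b \<in> carrier G"
    and "({i, j}, a) \<in> cl X" "({j, k}, b) \<in> cl X"
  shows "({i, k}, a \<otimes> b) \<in> cl X"
  by (rule triangle_clos[OF assms(1-6)]) (use assms in auto)

lemma triangle_jk:
  assumes "1 \<le> i" "i < j" "j < k" "k \<le> n" "a \<in> carrier G" "b \<in> carrier G"
    and "({i, j}, a) \<in> cl X" "({i, k}, b) \<in> cl X"
  shows "({j, k}, inv a \<otimes> b) \<in> cl X"
  by (rule triangle_clos[OF assms(1-5), of "inv a \<otimes> b"]) (use assms in auto)

lemma triangle_ij:
  assumes "1 \<le> i" "i < j" "j < k" "k \<le> n" "a \<in> carrier G" "b \<in> carrier G"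
    and "({j, k}, a) \<in> cl X" "({i, k}, b) \<in> cl X"
  shows "({i, j}, b \<otimes> inv a) \<in> cl X"
  by (rule triangle_clos[OF assms(1-4), of "b \<otimes> inv a" a]) (use assms in \<open>auto simp: m_assoc\<close>)

text \<open>A spanning tree that stands for all edges labelled \<open>\<one>\<close>: balanced
  triangles put the others into its closure. Contraction is expressed by closures of sets containing
  it, and its size of at most \<open>n - 1\<close> gives the rank bounds.\<close>

definition star :: "(nat set \<times> 'a) set" where
  "star = (\<lambda>j. ({1, j}, \<one>)) ` {2..n}"

lemma in_star: "j \<in> {2..n} \<Longrightarrow> ({1, j}, \<one>) \<in> star"
  by (auto simp: star_def)

lemma star_EE: "star \<subseteq> EE"
  by (auto simp: star_def EE_iff)

lemma card_star: "card star \<le> n - 1"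
  using card_image_le[of "{2..n}" "\<lambda>j. ({1, j}, \<one>)"] by (simp add: star_def)

lemma grank_ge:
  assumes "X \<subseteq> EE" "\<And>v. v \<in> {2..m} \<Longrightarrow> conn X 1 v"
  shows "m - 1 \<le> grank X"
proof -
  have "{2..m} \<subseteq> non_roots X" using assms(2) by (force simp: non_roots_def)
  then show ?thesis using card_mono[OF finite_non_roots[OF assms(1)], of "{2..m}"] by (simp add: grank_def)
qed

lemma grank_star: "star \<subseteq> X \<Longrightarrow> X \<subseteq> EE \<Longrightarrow> n - 1 \<le> grank X"
  by (rule grank_ge, assumption) (rule conn_edge[OF subsetD[OF _ in_star]], auto)

lemma grank_parallel_le:
  assumes "X \<subseteq> EE" "\<And>e. e \<in> X \<Longrightarrow> fst e = {a, b}"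
  shows "grank X \<le> 1"
  using finite_sub[OF assms(1)] assms
proof (induction X)
  case (insert e X)
  show ?case
  proof (cases "X = {}")
    case True
    then show ?thesis using r_le_card[of "{e}"] insert.prems by simp
  next
    case False
    then have "conn X a b" using conn_edge insert.prems by blast
    then have "grank (insert e X) = grank X" using grank_insert_conn insert.prems by blast
    then show ?thesis using insert by simp
  qed
qed (simp add: r_empty)

text \<open>The digon is a cycle of the graph but, being unbalanced, no circuit of the lift. Its
  single edges have graphic rank 1 and so are independent; a dependent digon would be a
  circuit.\<close>

lemma rk_digon:
  assumes "1 \<le> i" "i < j" "j \<le> n" "a \<in> carrier G" "b \<in> carrier G" "a \<noteq> b"
  shows "rk L {({i, j}, a), ({i, j}, b)} = 2"
proof -
  let ?C = "{({i, j}, a), ({i, j}, b)}"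
  have EE: "({i, j}, a) \<in> EE" "({i, j}, b) \<in> EE" using assms by (auto simp: EE_iff)
  have single: "{e} \<in> indep L" if e: "e \<in> EE" for e
  proof -
    obtain u v where uv: "fst e = {u, v}" using ends_E[OF e] by blast
    have "\<not> conn {} u v" using conn_imp_incident ends_neq[OF e uv] by blast
    then have "grank {e} = 1" using grank_insert_not_conn[of "{}" e] e uv r_empty by simp
    then have "1 \<le> rk L {e}" using grank_le_rk[of "{e}"] e by simp
    then show ?thesis using L.rk_le_card[of "{e}"] by (simp add: L.indep_iff_rk)
  qed
  have "\<not> circuit L ?C" using digon_cycle[OF assms] circuit_iff by blast
  moreover have "X \<in> indep L" if "X \<subset> ?C" for X
  proof -
    have "X \<subseteq> {({i, j}, a)} \<or> X \<subseteq> {({i, j}, b)}" using that by blast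
    then show ?thesis using single EE L.indep_subset by blast
  qed
  ultimately have "?C \<in> indep L" using EE ground_L unfolding circuit_def by blast
  then show ?thesis using L.rk_indep assms(6) by simp
qed

lemma clos_star_unit:
  assumes "star \<subseteq> X" "1 \<le> i" "i < j" "j \<le> n"
  shows "({i, j}, \<one>) \<in> cl X"
proof -
  have *: "({1, k}, \<one>) \<in> cl X" if "k \<in> {2..n}" for k
    by (rule in_clos[OF subsetD[OF assms(1) in_star[OF that]]])
  show ?thesis
  proof (cases "i = 1")
    case False
    then have "({i, j}, inv \<one> \<otimes> \<one>) \<in> cl X"
      by (intro triangle_jk[of 1]) (use assms * in auto)
    then show ?thesis by simp
  qed (use assms * in auto)
qed

lemma clos_star_iff:
  assumes "star \<subseteq> X" "1 \<le> i" "i < j" "j \<le> n" "b \<in> carrier G"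
  shows "({i, j}, b) \<in> cl X \<longleftrightarrow> ({1, 2}, b) \<in> cl X"
proof -
  note unit = clos_star_unit[OF assms(1)]
  have 1: "({1, k}, b) \<in> cl X \<longleftrightarrow> ({1, 2}, b) \<in> cl X" if "1 < k" "k \<le> n" for k
  proof (cases "k = 2")
    case False
    then show ?thesis
      using triangle_ik[of 1 2 k b \<one> X] triangle_ij[of 1 2 k \<one> b X] unit[of 2 k] that assms(5) by auto
  qed simp
  show ?thesis
  proof (cases "i = 1")
    case False
    then have "({i, j}, b) \<in> cl X \<longleftrightarrow> ({1, j}, b) \<in> cl X"
      using triangle_ik[of 1 i j \<one> b X] triangle_jk[of 1 i j \<one> b X] unit[of 1 i] assms by auto
    then show ?thesis using 1[of j] assms by simp
  qed (use 1[of j] assms in simp)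
qed

definition grp :: "(nat set \<times> 'a) set \<Rightarrow> 'a set" where
  "grp X = {b \<in> carrier G. ({1, 2}, b) \<in> cl X}"

text \<open>In the triangle 123, label \<open>b\<close> on 12 and \<open>\<one>\<close> on 13 force
  \<open>inv b\<close> on 23, and labels \<open>b\<close> on 12 and \<open>c\<close> on 23 force the
  product on 13. \<open>clos_star_iff\<close> moves the results back to 12.\<close>

lemma subgroup_grp:
  assumes "star \<subseteq> X"
  shows "subgroup (grp X) G"
proof (rule subgroupI)
  note star_iff = clos_star_iff[OF assms] and unit = clos_star_unit[OF assms]
  show "grp X \<subseteq> carrier G" by (auto simp: grp_def)
  show "grp X \<noteq> {}" using unit[of 1 2] three_le by (auto simp: grp_def)
  show "inv b \<in> grp X" if "b \<in> grp X" for b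
  proof -
    have "({2, 3}, inv b \<otimes> \<one>) \<in> cl X"
      by (rule triangle_jk[of 1]) (use that three_le unit in \<open>auto simp: grp_def\<close>)
    then show ?thesis using star_iff[of 2 3 "inv b"] that three_le by (simp add: grp_def)
  qed
  show "b \<otimes> c \<in> grp X" if "b \<in> grp X" "c \<in> grp X" for b c
  proof -
    have "({1, 3}, b \<otimes> c) \<in> cl X"
      by (rule triangle_ik[of 1 2]) (use that three_le star_iff[of 2 3 c] in \<open>auto simp: grp_def\<close>)
    then show ?thesis using star_iff[of 1 3 "b \<otimes> c"] that three_le by (simp add: grp_def)
  qed
qed

definition cls :: "'a \<Rightarrow> 'a set" where
  "cls a = grp (insert ({1, 2}, a) star)"

lemma subgroup_cls: "subgroup (cls a) G"
  unfolding cls_def by (rule subgroup_grp) auto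

lemma cls_closed: "b \<in> cls a \<Longrightarrow> b \<in> carrier G"
  by (simp add: cls_def grp_def)

lemma cls_refl: "a \<in> carrier G \<Longrightarrow> a \<in> cls a"
  using in_clos[OF insertI1] by (simp add: cls_def grp_def)

lemma cls_mono: "b \<in> cls a \<Longrightarrow> cls b \<subseteq> cls a"
proof -
  assume "b \<in> cls a"
  then have "insert ({1, 2}, b) star \<subseteq> cl (insert ({1, 2}, a) star)"
    using L.clos_increasing[of "insert ({1, 2}, a) star"] by (auto simp: cls_def grp_def)
  then have "cl (insert ({1, 2}, b) star) \<subseteq> cl (insert ({1, 2}, a) star)" by (rule L.clos_trans)
  then show "cls b \<subseteq> cls a" by (auto simp: cls_def grp_def)
qed

text \<open>Otherwise the tree together with this edge would have excess 0, whereas it contains the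
  digon with labels \<open>\<one>\<close> and \<open>a\<close>, whose excess is at least 1.\<close>

lemma not_clos_star:
  assumes "a \<in> carrier G" "a \<noteq> \<one>"
  shows "({1, 2}, a) \<notin> cl star"
proof
  let ?Y = "insert ({1, 2}, a) star"
  let ?C = "{({1, 2}, \<one>), ({1, 2}, a)}"
  assume "({1, 2}, a) \<in> cl star"
  then have "rk L ?Y \<le> n - 1"
    using L.rk_le_card[of star] card_star finite_sub[OF star_EE] by (simp add: clos_def)
  moreover have "({1, 2}, \<one>) \<in> star" using three_le by (auto simp: star_def)
  then have "?C \<subseteq> ?Y" by auto
  moreover have "?Y \<subseteq> EE" using star_EE assms three_le by (simp add: EE_iff)
  moreover have "rk L ?C = 2" by (rule rk_digon) (use assms three_le in auto)
  moreover have "grank ?C \<le> 1"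
    by (rule grank_parallel_le[of _ 1 2]) (use assms three_le in \<open>auto simp: EE_iff\<close>)
  ultimately show False using lift_rank_le[of ?C ?Y] grank_star[of ?Y] three_le by auto
qed

lemma cls_eq:
  assumes "b \<in> cls a" "b \<noteq> \<one>" "a \<in> carrier G"
  shows "cls b = cls a"
proof -
  have "b \<in> carrier G" using assms cls_closed by blast
  then have "({1, 2}, a) \<in> cl (insert ({1, 2}, b) star)"
    using L.clos_exchange[of "({1, 2}, b)" "({1, 2}, a)" star] not_clos_star assms
    by (simp add: cls_def grp_def)
  then have "a \<in> cls b" using assms by (simp add: cls_def grp_def)
  then show ?thesis using cls_mono assms(1) by blast
qed

text \<open>This is where the rank hypothesis enters. If one class contained all labels, the tree
  and one more edge would span the lift, so its rank would be at most \<open>n\<close>, while the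
  graphic rank is at least \<open>n - 1\<close>.\<close>

lemma cls_neq_carrier: "a \<in> carrier G \<Longrightarrow> cls a \<noteq> carrier G"
proof
  let ?Y = "insert ({1, 2}, a) star"
  assume a: "a \<in> carrier G" and "cls a = carrier G"
  then have "({1, 2}, b) \<in> cl ?Y" if "b \<in> carrier G" for b using that by (auto simp: cls_def grp_def)
  then have "({i, j}, b) \<in> cl ?Y" if "1 \<le> i" "i < j" "j \<le> n" "b \<in> carrier G" for i j b
    using clos_star_iff[of ?Y i j b] that by auto
  then have "EE \<subseteq> cl ?Y" by (auto elim!: EE_cases)
  then have "rk L EE \<le> rk L ?Y" by (rule L.rk_le_if_subset_clos)
  also have "\<dots> \<le> n"
    using L.rk_insert_le[of "({1, 2}, a)" star] L.rk_le_card[of star] card_star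
      finite_sub[OF star_EE] three_le by linarith
  finally have "matroid_rank L \<le> n" by (simp add: L.matroid_rank_eq_rk ground_L)
  moreover have "matroid_rank (gain_cycle_matroid n G) = grank EE"
    using matroid.matroid_rank_eq_rk[OF matroid_cycle_matroid] rk_cycle_matroid[of EE]
    by (simp add: cycle_matroid_def)
  ultimately show False using excess_rank grank_star[OF star_EE] three_le by simp
qed

definition parts :: "'a set set" where
  "parts = (\<lambda>a. cls a - {\<one>}) ` (carrier G - {\<one>})"

lemma partition_parts:
  assumes "carrier G \<noteq> {\<one>}"
  shows "nontrivial_group_partition G parts"
  unfolding nontrivial_group_partition_def
proof (intro conjI ballI)
  show "partition_on (carrier G - {\<one>}) parts"
  proof (rule partition_onI)
    show "\<Union> parts = carrier G - {\<one>}" using cls_closed cls_refl by (auto simp: parts_def)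
    show "{} \<notin> parts" using cls_refl by (auto simp: parts_def)
    show "disjnt A B" if AB: "A \<in> parts" "B \<in> parts" "A \<noteq> B" for A B
    proof (rule ccontr)
      assume "\<not> disjnt A B"
      then obtain x where "x \<in> A" "x \<in> B" by (auto simp: disjnt_def)
      moreover obtain a b where "a \<in> carrier G" "b \<in> carrier G" "A = cls a - {\<one>}" "B = cls b - {\<one>}"
        using AB(1,2) by (auto simp: parts_def)
      ultimately have "A = B" using cls_eq[of x a] cls_eq[of x b] by simp
      then show False using AB(3) by simp
    qed
  qed
  have fin: "finite parts" using finite_carrier by (simp add: parts_def)
  obtain a where a: "a \<in> carrier G" "a \<noteq> \<one>" using assms by blast
  obtain b where b: "b \<in> carrier G" "b \<notin> cls a"
    using cls_neq_carrier[OF a(1)] cls_closed[of _ a] by blast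
  have "b \<noteq> \<one>" using b subgroup.one_closed[OF subgroup_cls] by blast
  then have "cls a - {\<one>} \<in> parts" "cls b - {\<one>} \<in> parts" "cls a - {\<one>} \<noteq> cls b - {\<one>}"
    using a b cls_refl by (auto simp: parts_def)
  then have "card {cls a - {\<one>}, cls b - {\<one>}} = 2" "{cls a - {\<one>}, cls b - {\<one>}} \<subseteq> parts" by auto
  then show "2 \<le> card parts" using card_mono[OF fin] by metis
  fix A assume "A \<in> parts"
  then obtain c where "A = cls c - {\<one>}" by (auto simp: parts_def)
  moreover have "\<one> \<in> cls c" using subgroup.one_closed[OF subgroup_cls] .
  ultimately have "A \<union> {\<one>} = cls c" by auto
  then show "subgroup (A \<union> {\<one>}) G" using subgroup_cls by simp
qed

text \<open>
  Two digons with edges \<open>1, b\<close> between \<open>1, 2\<close> and between \<open>3, 4\<close> have excess 1, as one sees by joining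
  them by the edge \<open>23\<close> with label \<open>1\<close>. As the excess does not change when a bridge is added,
  it is still 1 after joining them by the edge \<open>23\<close> with label \<open>g\<close> instead.
\<close>

lemma cls_conj:
  assumes "4 \<le> n" "b \<in> carrier G" "b \<noteq> \<one>" "g \<in> carrier G"
  shows "g \<otimes> b \<otimes> inv g \<in> cls b"
proof -
  let ?x = "g \<otimes> b \<otimes> inv g"
  let ?X = "{({1, 2}, \<one>), ({1, 2}, b), ({3, 4}, \<one>), ({3, 4}, b)} :: (nat set \<times> 'a) set"
  let ?X1 = "insert ({2, 3}, \<one>) ?X" and ?Y = "insert ({2, 3}, g) ?X"
  \<comment> \<open>Four edges that span \<open>?X1\<close>: label \<open>b\<close> travels from 12
    over 13 and 14 to 34 with the help of edges labelled \<open>\<one>\<close>.\<close>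
  let ?Z = "{({1, 2}, \<one>), ({1, 2}, b), ({3, 4}, \<one>), ({2, 3}, \<one>)} :: (nat set \<times> 'a) set"
  let ?C = "{({1, 2}, \<one>), ({1, 2}, b), ({1, 2}, ?x)} :: (nat set \<times> 'a) set"
  have EE: "?X1 \<subseteq> EE" "?Y \<subseteq> EE" "?C \<subseteq> EE" using assms by (auto simp: EE_iff)
  have inZ: "e \<in> ?Z \<Longrightarrow> e \<in> cl ?Z" for e by (rule in_clos)
  have "({1, 3}, \<one> \<otimes> \<one>) \<in> cl ?Z" "({1, 3}, b \<otimes> \<one>) \<in> cl ?Z"
    by (rule triangle_ik[of 1 2]; use assms inZ in simp)+
  then have 13: "({1, 3}, \<one>) \<in> cl ?Z" "({1, 3}, b) \<in> cl ?Z" using assms by auto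
  have "({1, 4}, b \<otimes> \<one>) \<in> cl ?Z"
    by (rule triangle_ik[of 1 3]) (use assms inZ 13 in simp_all)
  then have "({3, 4}, inv \<one> \<otimes> b) \<in> cl ?Z"
    by (intro triangle_jk[of 1]) (use assms 13 in simp_all)
  then have "?X1 \<subseteq> cl ?Z" using inZ assms by auto
  then have "rk L ?X1 \<le> rk L ?Z" by (rule L.rk_le_if_subset_clos)
  also have "\<dots> \<le> card ?Z" by (rule L.rk_le_card) simp
  also have "\<dots> \<le> 4" by (simp add: card_insert_if)
  finally have X1: "rk L ?X1 \<le> 4" .
  have "\<not> conn ?X 2 3"
  proof
    have "v \<in> {1, 2}" if "conn ?X 2 v" for v
      using that unfolding conn_def
    proof (induction rule: rtranclp_induct)
      case (step y z)
      have "\<forall>e\<in>?X. fst e \<in> {{1, 2}, {3, 4}}" by simp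
      then have "{y, z} \<in> {{1, 2}, {3, 4}}" using step.hyps(2) by metis
      then show ?case using step.IH by (auto simp: doubleton_eq_iff)
    qed simp
    moreover assume "conn ?X 2 3"
    ultimately show False by fastforce
  qed
  then have "grank ?X1 = Suc (grank ?X)"
    using EE(1) by (intro grank_insert_not_conn[of _ _ 2 3]) auto
  moreover have "rk L ?X + grank ?X1 \<le> rk L ?X1 + grank ?X"
    by (rule lift_rank_le) (use EE in blast)+
  ultimately have "rk L ?X \<le> 3" using X1 by linarith
  then have Y: "rk L ?Y \<le> 4" using L.rk_insert_le[of "({2, 3}, g)" ?X] by simp
  have inY: "e \<in> ?Y \<Longrightarrow> e \<in> cl ?Y" for e by (rule in_clos)
  \<comment> \<open>The path 2, 3, 4 yields the label \<open>g \<otimes> b\<close> on 24, which the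
    edge 12 labelled \<open>\<one>\<close> carries to 14. Dividing by the other label
    \<open>g\<close> on 24 leaves the conjugate on 12.\<close>
  have "({2, 4}, g \<otimes> b) \<in> cl ?Y" "({2, 4}, g \<otimes> \<one>) \<in> cl ?Y"
    by (rule triangle_ik[of 2 3]; use assms inY in simp)+
  then have 24: "({2, 4}, g \<otimes> b) \<in> cl ?Y" "({2, 4}, g) \<in> cl ?Y" using assms by auto
  have "({1, 4}, \<one> \<otimes> (g \<otimes> b)) \<in> cl ?Y"
    by (rule triangle_ik[of 1 2]) (use assms inY 24 in simp_all)
  then have "({1, 2}, ?x) \<in> cl ?Y"
    by (intro triangle_ij[of 1 2 4]) (use assms 24 in simp_all)
  then have "?Y \<union> ?C \<subseteq> cl ?Y" using inY by auto
  then have YC: "rk L (?Y \<union> ?C) \<le> 4" using L.rk_le_if_subset_clos Y by (meson order_trans)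
  \<comment> \<open>Rank at most 4 on a graph connecting four vertices means excess at most 1. The
    parallel edges in \<open>?C\<close> then have rank at most 2, which is the rank of the digon
    that they contain.\<close>
  have "4 - 1 \<le> grank (?Y \<union> ?C)"
  proof (rule grank_ge)
    let ?W = "?Y \<union> ?C"
    have 12: "conn ?W 1 2" by (rule conn_edge[of "({1, 2}, \<one>)"]) auto
    have 23: "conn ?W 2 3" by (rule conn_edge[of "({2, 3}, g)"]) auto
    have 34: "conn ?W 3 4" by (rule conn_edge[of "({3, 4}, \<one>)"]) auto
    fix v :: nat assume "v \<in> {2..4}"
    then consider "v = 2" | "v = 3" | "v = 4" by force
    then show "conn ?W 1 v"
      using 12 conn_trans[OF 12 23] conn_trans[OF conn_trans[OF 12 23] 34] by cases simp_all
  qed (rule Un_least[OF EE(2,3)])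
  moreover have "grank ?C \<le> 1"
    by (rule grank_parallel_le[OF EE(3), of 1 2]) auto
  moreover have "rk L ?C + grank (?Y \<union> ?C) \<le> rk L (?Y \<union> ?C) + grank ?C"
    by (rule lift_rank_le[OF Un_upper2 Un_least[OF EE(2,3)]])
  ultimately have "rk L ?C \<le> 2" using YC by linarith
  moreover have "rk L {({1, 2}, \<one>), ({1, 2}, b)} = 2" by (rule rk_digon) (use assms in auto)
  moreover have "insert ({1, 2}, ?x) {({1, 2}, \<one>), ({1, 2}, b)} = ?C" by auto
  ultimately have "({1, 2}, ?x) \<in> cl {({1, 2}, \<one>), ({1, 2}, b)}"
    using L.rk_insert_mono[of "{({1, 2}, \<one>), ({1, 2}, b)}" "({1, 2}, ?x)"] by (simp add: clos_def)
  moreover have "{({1, 2}, \<one>), ({1, 2}, b)} \<subseteq> insert ({1, 2}, b) star"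
    using assms by (auto simp: star_def)
  ultimately have "({1, 2}, ?x) \<in> cl (insert ({1, 2}, b) star)" using L.clos_mono by blast
  then show ?thesis using assms by (simp add: cls_def grp_def)
qed

lemma parts_conj:
  assumes "4 \<le> n" "A \<in> parts" "x \<in> A" "g \<in> carrier G"
  shows "g \<otimes> x \<otimes> inv g \<in> A"
proof -
  obtain a where a: "a \<in> carrier G" "A = cls a - {\<one>}" using assms(2) by (auto simp: parts_def)
  have x: "x \<in> carrier G" "x \<noteq> \<one>" "cls x = cls a" using a assms cls_closed cls_eq by auto
  have "g \<otimes> x \<otimes> inv g \<in> cls a" using cls_conj[OF assms(1) x(1,2) assms(4)] x by simp
  moreover have "g \<otimes> x \<otimes> inv g \<noteq> \<one>" using conj_eq_one_iff x assms(4) by blast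
  ultimately show ?thesis using a by simp
qed

end

section \<open>Partitions of groups\<close>

context group
begin

lemma partition_closed:
  assumes "nontrivial_group_partition G P" "A \<in> P" "x \<in> A"
  shows "x \<in> carrier G" "x \<noteq> \<one>"
  using assms by (auto simp: nontrivial_group_partition_def partition_on_def)

lemma partition_nonempty:
  assumes "nontrivial_group_partition G P"
  shows "P \<noteq> {}" "A \<in> P \<Longrightarrow> \<exists>x. x \<in> A"
proof -
  show "P \<noteq> {}" using assms by (auto simp: nontrivial_group_partition_def)
  have "{} \<notin> P" using assms by (simp add: nontrivial_group_partition_def partition_on_def)
  then show "A \<in> P \<Longrightarrow> \<exists>x. x \<in> A" by (metis ex_in_conv)
qed

lemma partition_unique:
  assumes "nontrivial_group_partition G P" "A \<in> P" "B \<in> P" "x \<in> A" "x \<in> B"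
  shows "A = B"
  using assms by (auto simp: nontrivial_group_partition_def partition_on_def pairwise_def disjnt_def)

lemma partition_cover:
  assumes "nontrivial_group_partition G P" "x \<in> carrier G" "x \<noteq> \<one>"
  obtains A where "A \<in> P" "x \<in> A"
  using assms by (auto simp: nontrivial_group_partition_def partition_on_def)

lemma partition_subgroup:
  assumes "nontrivial_group_partition G P" "A \<in> P"
  shows "subgroup (A \<union> {\<one>}) G"
  using assms by (auto simp: nontrivial_group_partition_def)

lemma partition_other:
  assumes "nontrivial_group_partition G P" "A \<in> P"
  obtains B y where "B \<in> P" "B \<noteq> A" "y \<in> B" "y \<notin> A"
proof -
  have "\<not> P \<subseteq> {A}"
    using assms card_mono[of "{A}" P] by (auto simp: nontrivial_group_partition_def)
  then obtain B where B: "B \<in> P" "B \<noteq> A" by blast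
  then obtain y where "y \<in> B" using partition_nonempty(2)[OF assms(1)] by blast
  then show thesis using that B partition_unique[OF assms(1,2) B(1)] by metis
qed

lemma partition_proper:
  assumes "nontrivial_group_partition G P" "A \<in> P"
  shows "A \<union> {\<one>} \<noteq> carrier G"
proof -
  obtain B y where "B \<in> P" "y \<in> B" "y \<notin> A" using partition_other[OF assms] by metis
  then have "y \<in> carrier G" "y \<notin> A \<union> {\<one>}" using partition_closed[OF assms(1)] by auto
  then show ?thesis by blast
qed

text \<open>By Lagrange a part with the identity adjoined would be trivial or the whole group, and
  it is neither. This excludes a single cyclic summand of prime order.\<close>

lemma partition_order_not_prime:
  assumes "finite (carrier G)" "nontrivial_group_partition G P" "prime (card (carrier G))"
  shows False
proof -
  obtain A x where A: "A \<in> P" and x: "x \<in> A" using partition_nonempty[OF assms(2)] by blast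
  let ?K = "A \<union> {\<one>}"
  have K: "subgroup ?K G" using partition_subgroup assms(2) A by blast
  have sub: "?K \<subseteq> carrier G" using subgroup.subset[OF K] .
  then have fin: "finite ?K" using assms(1) finite_subset by blast
  have "card ?K dvd card (carrier G)" using lagrange[OF K] by (metis dvd_triv_right order_def)
  moreover have "card ?K \<noteq> 1"
  proof
    assume "card ?K = 1"
    then obtain y where "?K = {y}" by (auto simp: card_1_singleton_iff)
    then show False using x partition_closed(2)[OF assms(2) A x] by auto
  qed
  ultimately have "card ?K = card (carrier G)" using assms(3) prime_nat_iff by blast
  then show False using card_subset_eq[OF assms(1) sub] partition_proper[OF assms(2) A] by blast
qed

text \<open>For different parts, normality puts the commutator of \<open>x\<close> and
  \<open>y\<close> into both subgroups, which meet only in \<open>\<one>\<close>. Elements of the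
  same part are compared through another part.\<close>

lemma normal_partition_commute:
  assumes P: "nontrivial_group_partition G P"
    and normal: "\<And>A x g. A \<in> P \<Longrightarrow> x \<in> A \<Longrightarrow> g \<in> carrier G \<Longrightarrow> g \<otimes> x \<otimes> inv g \<in> A"
    and xy: "x \<in> carrier G" "y \<in> carrier G"
  shows "x \<otimes> y = y \<otimes> x"
proof -
  have diff: "x \<otimes> y = y \<otimes> x" if AB: "A \<in> P" "B \<in> P" "A \<noteq> B" "x \<in> A" "y \<in> B" for A B x y
  proof -
    have c: "x \<in> carrier G" "y \<in> carrier G" using that partition_closed[OF P] by auto
    let ?z = "x \<otimes> y \<otimes> inv x \<otimes> inv y"
    have sA: "subgroup (A \<union> {\<one>}) G" and sB: "subgroup (B \<union> {\<one>}) G"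
      using partition_subgroup[OF P] that by auto
    have "x \<otimes> y \<otimes> inv x \<in> B \<union> {\<one>}" using normal AB c by auto
    moreover have "inv y \<in> B \<union> {\<one>}" using subgroup.m_inv_closed[OF sB] AB by blast
    ultimately have zB: "?z \<in> B \<union> {\<one>}" using subgroup.m_closed[OF sB] by blast
    have "inv x \<in> A \<union> {\<one>}" using subgroup.m_inv_closed[OF sA] AB by blast
    moreover have "inv x \<noteq> \<one>" using partition_closed(2)[OF P AB(1,4)] c by simp
    ultimately have "y \<otimes> inv x \<otimes> inv y \<in> A \<union> {\<one>}" using normal AB c by auto
    then have "x \<otimes> (y \<otimes> inv x \<otimes> inv y) \<in> A \<union> {\<one>}" using subgroup.m_closed[OF sA] AB by blast
    then have zA: "?z \<in> A \<union> {\<one>}" using c by (simp add: m_assoc)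
    have "?z = \<one>" using zA zB partition_unique[OF P AB(1,2)] AB(3) by blast
    then have "x \<otimes> y \<otimes> inv x = y" using c by (metis inv_closed inv_equality inv_inv m_closed)
    then show ?thesis using c by (metis inv_solve_right m_closed)
  qed
  consider "x = \<one>" | "y = \<one>" | "x \<noteq> \<one>" "y \<noteq> \<one>" by blast
  then show ?thesis
  proof cases
    case 3
    obtain A where A: "A \<in> P" "x \<in> A" using partition_cover[OF P xy(1) 3(1)] .
    obtain B where B: "B \<in> P" "y \<in> B" using partition_cover[OF P xy(2) 3(2)] .
    show ?thesis
    proof (cases "A = B")
      case True
      \<comment> \<open>Neither \<open>z\<close> nor \<open>x \<otimes> z\<close> lies in the part
        of \<open>y\<close>. So \<open>y\<close> commutes with both, and hence with
        \<open>x\<close>.\<close>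
      obtain C z where C: "C \<in> P" "C \<noteq> A" "z \<in> C" "z \<notin> A" using partition_other[OF P A(1)] .
      have z: "z \<in> carrier G" "z \<noteq> \<one>" using partition_closed[OF P C(1,3)] .
      have sA: "subgroup (A \<union> {\<one>}) G" using partition_subgroup[OF P A(1)] .
      have "x \<otimes> z \<notin> A \<union> {\<one>}"
      proof
        assume "x \<otimes> z \<in> A \<union> {\<one>}"
        then have "inv x \<otimes> (x \<otimes> z) \<in> A \<union> {\<one>}"
          using subgroup.m_closed[OF sA] subgroup.m_inv_closed[OF sA] A by blast
        then have "z \<in> A \<union> {\<one>}" using xy z by (simp flip: m_assoc)
        then show False using C z by blast
      qed
      moreover have "x \<otimes> z \<in> carrier G" using xy z by simp
      ultimately obtain D where D: "D \<in> P" "x \<otimes> z \<in> D" "D \<noteq> A"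
        using partition_cover[OF P, of "x \<otimes> z"] by blast
      have yz: "y \<otimes> z = z \<otimes> y" using diff[of A C y z] A B C True by blast
      have "(x \<otimes> z) \<otimes> y = y \<otimes> (x \<otimes> z)" using diff[of D A "x \<otimes> z" y] A B D True by blast
      then have "x \<otimes> y \<otimes> z = y \<otimes> x \<otimes> z" using xy z yz by (simp add: m_assoc)
      then show ?thesis using xy z by (metis m_closed right_cancel)
    qed (use diff A B in blast)
  qed (use xy in auto)
qed

lemma exists_prime_exponent_elem:
  assumes "finite (carrier G)" "x \<in> carrier G" "x \<noteq> \<one>"
  obtains p k :: nat where "prime p" "x [^] k \<noteq> \<one>" "(x [^] k) [^] p = \<one>"
proof -
  have "ord x \<noteq> 1" using pow_eq_id[OF assms(2), of 1] assms by auto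
  then obtain p where p: "prime p" "p dvd ord x" using prime_factor_nat by blast
  then obtain k where k: "ord x = p * k" by blast
  have "ord x \<noteq> 0"
    using ord_dvd_group_order[OF assms(2)] assms(1) order_gt_0_iff_finite by (metis dvd_0_left_iff less_not_refl)
  then have "0 < k" "k < ord x" using k prime_gt_1_nat[OF p(1)] by auto
  then have "\<not> ord x dvd k" by (metis dvd_imp_le leD)
  then have "x [^] k \<noteq> \<one>" using pow_eq_id[OF assms(2)] by blast
  moreover have "(x [^] k) [^] p = \<one>"
    using pow_ord_eq_1[OF assms(2)] assms(2) k by (simp add: nat_pow_pow mult.commute)
  ultimately show thesis using that p by blast
qed

end

text \<open>Let \<open>x\<close> have exponent \<open>p\<close> and let \<open>y\<close> lie in a
  different part \<open>B\<close>. Then \<open>x \<otimes> y\<close> is in a part other than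
  \<open>B\<close>, but its \<open>p\<close>-th power equals that of \<open>y\<close>; this power
  lies in two subgroups that meet trivially. So the exponent passes from one element to all other
  parts, and from one of these back to the first.\<close>

lemma (in comm_group) partition_exponent:
  assumes fin: "finite (carrier G)" and P: "nontrivial_group_partition G P"
  shows "\<exists>p::nat. prime p \<and> (\<forall>x\<in>carrier G. x [^] p = \<one>)"
proof -
  have pow_mem: "x [^] (k::nat) \<in> A \<union> {\<one>}" if "A \<in> P" "x \<in> A" for A x k
  proof (induction k)
    case (Suc k)
    then show ?case
      using subgroup.m_closed[OF partition_subgroup[OF P that(1)] Suc] that by simp
  qed simp
  have step: "y [^] p = \<one>"
    if A: "A \<in> P" "x \<in> A" "x [^] p = \<one>" and y: "y \<in> carrier G" "y \<notin> A" for A x y and p :: nat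
  proof (cases "y = \<one>")
    case False
    have x: "x \<in> carrier G" using partition_closed[OF P] A by blast
    obtain B where B: "B \<in> P" "y \<in> B" using partition_cover[OF P y(1) False] .
    have sB: "subgroup (B \<union> {\<one>}) G" using partition_subgroup[OF P B(1)] .
    have "x \<otimes> y \<notin> B \<union> {\<one>}"
    proof
      assume "x \<otimes> y \<in> B \<union> {\<one>}"
      then have "(x \<otimes> y) \<otimes> inv y \<in> B \<union> {\<one>}"
        using subgroup.m_closed[OF sB] subgroup.m_inv_closed[OF sB] B by blast
      then have "x \<in> B \<union> {\<one>}" using x y by (simp add: m_assoc)
      then show False using partition_unique[OF P A(1) B(1) A(2)] partition_closed(2)[OF P A(1,2)] B y by blast
    qed
    moreover have "x \<otimes> y \<in> carrier G" using x y by simp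
    ultimately obtain C where C: "C \<in> P" "x \<otimes> y \<in> C" "C \<noteq> B"
      using partition_cover[OF P, of "x \<otimes> y"] by blast
    have "(x \<otimes> y) [^] p = y [^] p" using x y A by (simp add: nat_pow_distrib)
    then have "y [^] p \<in> C \<union> {\<one>}" using pow_mem[OF C(1,2), of p] by simp
    moreover have "y [^] p \<in> B \<union> {\<one>}" using pow_mem[OF B] .
    ultimately show ?thesis using partition_unique[OF P C(1) B(1)] C(3) by blast
  qed simp
  obtain A a where A: "A \<in> P" and a: "a \<in> A" using partition_nonempty[OF P] by blast
  obtain p k :: nat where p: "prime p" "a [^] k \<noteq> \<one>" "(a [^] k) [^] p = \<one>"
    using exists_prime_exponent_elem[OF fin partition_closed[OF P A a]] .
  have ak: "a [^] k \<in> A" using pow_mem[OF A a, of k] p by blast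
  obtain B b where B: "B \<in> P" "B \<noteq> A" "b \<in> B" "b \<notin> A" using partition_other[OF P A] .
  have b: "b [^] p = \<one>" using step[OF A ak p(3)] partition_closed[OF P B(1,3)] B by blast
  have "x [^] p = \<one>" if x: "x \<in> carrier G" for x
  proof (cases "x \<in> A")
    case True
    then have "x \<notin> B" using partition_unique[OF P A B(1)] B by blast
    then show ?thesis using step[OF B(1,3) b x] by blast
  qed (use step[OF A ak p(3) x] in blast)
  then show ?thesis using p by blast
qed

section \<open>Elementary abelian groups as sums of cyclic groups\<close>

lemma carrier_sum_integer_mod_group:
  assumes "0 < p"
  shows "carrier (sum_group {..<j::nat} (\<lambda>_. integer_mod_group p)) = {..<j} \<rightarrow>\<^sub>E {0..<int p}"
  using assms by (auto simp: carrier_sum_group carrier_integer_mod_group)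

lemma card_sum_integer_mod_group:
  assumes "0 < p"
  shows "card (carrier (sum_group {..<j::nat} (\<lambda>_. integer_mod_group p))) = p ^ j"
  using carrier_sum_integer_mod_group[OF assms] by (simp add: card_PiE)

context comm_group
begin

lemma int_pow_mod:
  assumes "x \<in> carrier G" "x [^] (p::nat) = \<one>"
  shows "x [^] (k mod int p) = x [^] (k::int)"
proof -
  have "k = int p * (k div int p) + k mod int p" by simp
  then have "x [^] k = x [^] (int p * (k div int p)) \<otimes> x [^] (k mod int p)"
    using assms(1) int_pow_mult by metis
  also have "x [^] (int p * (k div int p)) = \<one>"
    using assms by (simp add: int_pow_int flip: int_pow_pow)
  finally show ?thesis using assms by simp
qed

text \<open>A linear combination over the field with \<open>p\<close> elements in multiplicative
  notation, with coefficients \<open>f i\<close> taken as integer representatives.\<close>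

definition comb :: "(nat \<Rightarrow> 'a) \<Rightarrow> nat \<Rightarrow> (nat \<Rightarrow> int) \<Rightarrow> 'a" where
  "comb x j f = finprod G (\<lambda>i. x i [^] f i) {..<j}"

lemma comb_closed: "(\<And>i. i < j \<Longrightarrow> x i \<in> carrier G) \<Longrightarrow> comb x j f \<in> carrier G"
  unfolding comb_def by (rule finprod_closed) auto

lemma comb_hom:
  assumes "\<And>i. i < j \<Longrightarrow> x i \<in> carrier G" "\<And>i. i < j \<Longrightarrow> x i [^] p = \<one>"
  shows "group_hom (sum_group {..<j} (\<lambda>_. integer_mod_group p)) G (comb x j)"
proof -
  let ?S = "sum_group {..<j} (\<lambda>_. integer_mod_group p)"
  have "comb x j \<in> hom ?S G"
  proof (rule homI)
    show "comb x j f \<in> carrier G" for f by (rule comb_closed) (rule assms)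
    fix f g
    have "comb x j (f \<otimes>\<^bsub>?S\<^esub> g) = finprod G (\<lambda>i. x i [^] f i \<otimes> x i [^] g i) {..<j}"
      unfolding comb_def
      by (rule finprod_cong') (use assms int_pow_mod in \<open>auto simp: int_pow_mult\<close>)
    also have "\<dots> = comb x j f \<otimes> comb x j g"
      unfolding comb_def by (rule finprod_multf) (use assms in auto)
    finally show "comb x j (f \<otimes>\<^bsub>?S\<^esub> g) = comb x j f \<otimes> comb x j g" .
  qed
  then show ?thesis by (simp add: group_hom_def group_hom_axioms_def is_group)
qed

text \<open>
  A longest sequence of elements that is independent over the field with \<open>p\<close> elements is a basis.
\<close>

lemma elementary_abelian_iso:
  assumes fin: "finite (carrier G)" and p: "prime p"
    and exp: "\<And>x. x \<in> carrier G \<Longrightarrow> x [^] (p::nat) = \<one>"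
  shows "\<exists>j. G \<cong> sum_group {..<j::nat} (\<lambda>_. integer_mod_group p)"
proof -
  let ?S = "\<lambda>j::nat. sum_group {..<j} (\<lambda>_. integer_mod_group p)"
  have p0: "0 < p" using p prime_gt_0_nat by blast
  note carrier_S = carrier_sum_integer_mod_group[OF p0]
  \<comment> \<open>Linear independence of \<open>x 0, ..., x (j - 1)\<close>, stated as injectivity
    of their combinations. A largest \<open>j\<close> exists because
    \<open>j < 2 ^ j \<le> p ^ j \<le> card (carrier G)\<close>.\<close>
  define Q where "Q j \<longleftrightarrow> (\<exists>x. (\<forall>i<j. x i \<in> carrier G) \<and> inj_on (comb x j) (carrier (?S j)))" for j
  have hom: "group_hom (?S j) G (comb x j)" if "\<forall>i<j. x i \<in> carrier G" for x j
    by (rule comb_hom) (use that exp in auto)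
  have "carrier (?S 0) = {\<lambda>_. undefined}" using carrier_S[of 0] by simp
  then have "Q 0" by (auto simp: Q_def)
  moreover have "j \<le> card (carrier G)" if Q: "Q j" for j
  proof -
    obtain x where x: "\<forall>i<j. x i \<in> carrier G" "inj_on (comb x j) (carrier (?S j))"
      using Q by (auto simp: Q_def)
    have "j < 2 ^ j" by (rule less_exp)
    also have "(2::nat) ^ j \<le> p ^ j" using prime_ge_2_nat[OF p] by (rule power_mono) simp
    also have "p ^ j = card (carrier (?S j))" using card_sum_integer_mod_group[OF p0] by simp
    also have "\<dots> \<le> card (carrier G)"
      by (rule card_inj_on_le[OF x(2) _ fin]) (use comb_closed x(1) in blast)
    finally show ?thesis by simp
  qed
  ultimately obtain j where j: "Q j" "\<And>k. Q k \<Longrightarrow> k \<le> j"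
    using Nat.ex_has_greatest_nat[of Q 0 "card (carrier G)"] by blast
  then obtain x where x: "\<forall>i<j. x i \<in> carrier G" "inj_on (comb x j) (carrier (?S j))"
    by (auto simp: Q_def)
  interpret S: group_hom "?S j" G "comb x j" by (rule hom[OF x(1)])
  let ?I = "comb x j ` carrier (?S j)"
  have I: "subgroup ?I G" by (rule S.img_is_subgroup)
  have "y \<in> ?I" if y: "y \<in> carrier G" for y
  proof (rule ccontr)
    assume no: "y \<notin> ?I"
    let ?x = "x(j := y)"
    have x': "\<forall>i<Suc j. ?x i \<in> carrier G" using x y by auto
    interpret S': group_hom "?S (Suc j)" G "comb ?x (Suc j)" by (rule hom[OF x'])
    have "f = \<one>\<^bsub>?S (Suc j)\<^esub>" if f: "f \<in> carrier (?S (Suc j))" "comb ?x (Suc j) f = \<one>" for f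
    proof -
      let ?f = "restrict f {..<j}"
      have fS: "?f \<in> carrier (?S j)" using f(1) by (auto simp: carrier_S PiE_iff)
      have fI: "comb x j ?f \<in> ?I" using fS by (rule imageI)
      have c: "comb x j ?f \<in> carrier G" using S.hom_closed[OF fS] .
      have "comb ?x (Suc j) f = y [^] f j \<otimes> finprod G (\<lambda>i. ?x i [^] f i) {..<j}"
        unfolding comb_def lessThan_Suc
        by (subst finprod_insert) (use x y in auto)
      also have "finprod G (\<lambda>i. ?x i [^] f i) {..<j} = comb x j ?f"
        unfolding comb_def by (rule finprod_cong') (use x in auto)
      finally have "comb ?x (Suc j) f = y [^] f j \<otimes> comb x j ?f" .
      from trans[OF this[symmetric] f(2)] have eq: "y [^] f j \<otimes> comb x j ?f = \<one>" .
      then have "y [^] f j = inv (comb x j ?f)" using c y by (metis inv_equality int_pow_closed)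
      then have yI: "y [^] f j \<in> ?I" using subgroup.m_inv_closed[OF I fI] by simp
      have fj: "0 \<le> f j" "f j < int p" using f(1) by (auto simp: carrier_S PiE_iff)
      have "f j = 0"
      proof (rule ccontr)
        \<comment> \<open>A nonzero coefficient of \<open>y\<close> is invertible modulo
          \<open>p\<close>. With its inverse \<open>k\<close> from Bezout, the \<open>k\<close>-th
          power of an element of the span is \<open>y\<close> itself.\<close>
        assume "f j \<noteq> 0"
        then have "\<not> int p dvd f j" using fj by (auto dest: zdvd_imp_le)
        then have "coprime (f j) (int p)"
          using p by (metis coprime_commute prime_imp_coprime prime_int_nat_transfer nat_int of_nat_0_le_iff)
        then obtain k l where "k * f j + l * int p = 1" using bezout_int[of "f j" "int p"] by auto
        then have "(f j * k) mod int p = 1 mod int p" by (metis mod_mult_self1 mult.commute)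
        then have "y [^] (f j * k) = y [^] (1::int)" using int_pow_mod[OF y exp[OF y]] by metis
        moreover have "(y [^] f j) [^] k \<in> ?I" by (rule subgroup_int_pow_closed[OF I yI])
        ultimately have "y \<in> ?I" using y by (simp add: int_pow_pow)
        then show False using no by blast
      qed
      then have "comb x j ?f = \<one>" using eq c by simp
      then have "?f = \<one>\<^bsub>?S j\<^esub>" using x(2) fS S.inj_on_one_iff by blast
      then have "f i = 0" if "i < j" for i using that by (metis integer_mod_group_0 lessThan_iff one_integer_mod_group one_sum_group restrict_apply')
      then show ?thesis using \<open>f j = 0\<close> f(1)
        by (auto simp: carrier_S PiE_iff extensional_def fun_eq_iff less_Suc_eq)
    qed
    then have "inj_on (comb ?x (Suc j)) (carrier (?S (Suc j)))" using S'.inj_on_one_iff by blast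
    then have "Q (Suc j)" using x' unfolding Q_def by blast
    then show False using j(2) by fastforce
  qed
  then have "comb x j ` carrier (?S j) = carrier G" using S.hom_closed by blast
  then have "comb x j \<in> iso (?S j) G" using S.homh x(2) by (simp add: iso_def bij_betw_def)
  then have "?S j \<cong> G" by (auto simp: is_iso_def)
  moreover have "group (?S j)" by simp
  ultimately have "G \<cong> ?S j" using group.iso_sym by blast
  then show ?thesis by blast
qed

end

section \<open>A refinement of a partition that is invariant under conjugation\<close>

context group
begin

lemma conj_mult:
  assumes "g \<in> carrier G" "x \<in> carrier G" "y \<in> carrier G"
  shows "g \<otimes> (x \<otimes> y) \<otimes> inv g = (g \<otimes> x \<otimes> inv g) \<otimes> (g \<otimes> y \<otimes> inv g)"
proof -
  have "inv g \<otimes> (g \<otimes> (y \<otimes> inv g)) = y \<otimes> inv g" using assms by (simp flip: m_assoc)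
  then show ?thesis using assms by (simp add: m_assoc)
qed

lemma conj_conj:
  assumes "g \<in> carrier G" "h \<in> carrier G" "x \<in> carrier G"
  shows "g \<otimes> (h \<otimes> x \<otimes> inv h) \<otimes> inv g = (g \<otimes> h) \<otimes> x \<otimes> inv (g \<otimes> h)"
  using assms by (simp add: m_assoc inv_mult_group)

text \<open>The part of \<open>x\<close> in the common refinement of all conjugates of the partition \<open>P\<close>.\<close>

definition conj_refined :: "'a set set \<Rightarrow> 'a \<Rightarrow> 'a set" where
  "conj_refined P x = {y \<in> carrier G. \<forall>g\<in>carrier G. \<forall>A\<in>P.
     g \<otimes> x \<otimes> inv g \<in> A \<longrightarrow> g \<otimes> y \<otimes> inv g \<in> A \<union> {\<one>}}"

lemma subgroup_conj_refined:
  assumes "nontrivial_group_partition G P"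
  shows "subgroup (conj_refined P x) G"
proof (rule subgroupI)
  show "conj_refined P x \<subseteq> carrier G" by (auto simp: conj_refined_def)
  have "\<one> \<in> conj_refined P x" by (simp add: conj_refined_def)
  then show "conj_refined P x \<noteq> {}" by blast
  show "inv y \<in> conj_refined P x" if y: "y \<in> conj_refined P x" for y
  proof -
    have yc: "y \<in> carrier G" using y by (simp add: conj_refined_def)
    have "g \<otimes> inv y \<otimes> inv g \<in> A \<union> {\<one>}"
      if "g \<in> carrier G" "A \<in> P" "g \<otimes> x \<otimes> inv g \<in> A" for g A
    proof -
      have "g \<otimes> y \<otimes> inv g \<in> A \<union> {\<one>}" using y that by (simp add: conj_refined_def)
      then have "inv (g \<otimes> y \<otimes> inv g) \<in> A \<union> {\<one>}"
        using subgroup.m_inv_closed[OF partition_subgroup[OF assms that(2)]] by blast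
      then show ?thesis using yc that by (simp add: inv_mult_group m_assoc)
    qed
    then show ?thesis using yc unfolding conj_refined_def by blast
  qed
  show "y \<otimes> z \<in> conj_refined P x" if y: "y \<in> conj_refined P x" and z: "z \<in> conj_refined P x" for y z
  proof -
    have c: "y \<in> carrier G" "z \<in> carrier G" using y z by (simp_all add: conj_refined_def)
    have "g \<otimes> (y \<otimes> z) \<otimes> inv g \<in> A \<union> {\<one>}"
      if "g \<in> carrier G" "A \<in> P" "g \<otimes> x \<otimes> inv g \<in> A" for g A
    proof -
      have "g \<otimes> y \<otimes> inv g \<in> A \<union> {\<one>}" "g \<otimes> z \<otimes> inv g \<in> A \<union> {\<one>}"
        using y z that by (simp_all add: conj_refined_def)
      then show ?thesis
        using subgroup.m_closed[OF partition_subgroup[OF assms that(2)]] conj_mult[OF that(1) c] by simp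
    qed
    then show ?thesis using c unfolding conj_refined_def by blast
  qed
qed

lemma conj_refined_refl: "x \<in> carrier G \<Longrightarrow> x \<in> conj_refined P x"
  by (simp add: conj_refined_def)

text \<open>Every conjugate of \<open>x\<close> lies in some part, and the corresponding conjugate
  of \<open>z\<close>, being nontrivial, must lie in the same one. The definition depends on
  \<open>x\<close> only through these parts.\<close>

lemma conj_refined_eq:
  assumes P: "nontrivial_group_partition G P" and x: "x \<in> carrier G" "x \<noteq> \<one>"
    and z: "z \<in> conj_refined P x" "z \<noteq> \<one>"
  shows "conj_refined P z = conj_refined P x"
proof -
  have zc: "z \<in> carrier G" using z by (simp add: conj_refined_def)
  have "g \<otimes> z \<otimes> inv g \<in> A \<longleftrightarrow> g \<otimes> x \<otimes> inv g \<in> A" if g: "g \<in> carrier G" and A: "A \<in> P" for g A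
  proof -
    have "g \<otimes> x \<otimes> inv g \<in> carrier G" "g \<otimes> x \<otimes> inv g \<noteq> \<one>" using g x conj_eq_one_iff by auto
    then obtain B where B: "B \<in> P" "g \<otimes> x \<otimes> inv g \<in> B" using partition_cover[OF P] by metis
    have "g \<otimes> z \<otimes> inv g \<in> B \<union> {\<one>}" using z(1) g B by (simp add: conj_refined_def)
    then have "g \<otimes> z \<otimes> inv g \<in> B" using conj_eq_one_iff[OF g zc] z(2) by blast
    then show ?thesis using partition_unique[OF P A B(1)] B(2) by blast
  qed
  then show ?thesis unfolding conj_refined_def by blast
qed

lemma conj_refined_conj_subset:
  assumes "h \<in> carrier G" "x \<in> carrier G" "y \<in> conj_refined P x"
  shows "h \<otimes> y \<otimes> inv h \<in> conj_refined P (h \<otimes> x \<otimes> inv h)"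
proof -
  have y: "y \<in> carrier G" using assms by (simp add: conj_refined_def)
  have "g \<otimes> (h \<otimes> y \<otimes> inv h) \<otimes> inv g \<in> A \<union> {\<one>}"
    if g: "g \<in> carrier G" "A \<in> P" "g \<otimes> (h \<otimes> x \<otimes> inv h) \<otimes> inv g \<in> A" for g A
  proof -
    have "(g \<otimes> h) \<otimes> x \<otimes> inv (g \<otimes> h) \<in> A" using g conj_conj[OF g(1) assms(1,2)] by simp
    then have "(g \<otimes> h) \<otimes> y \<otimes> inv (g \<otimes> h) \<in> A \<union> {\<one>}"
      using assms(1,3) g(1,2) by (simp add: conj_refined_def)
    then show ?thesis using conj_conj[OF g(1) assms(1) y] by simp
  qed
  then show ?thesis using y assms(1) unfolding conj_refined_def by simp
qed

lemma conj_refined_conj: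
  assumes h: "h \<in> carrier G" and x: "x \<in> carrier G"
  shows "(\<lambda>y. h \<otimes> y \<otimes> inv h) ` conj_refined P x = conj_refined P (h \<otimes> x \<otimes> inv h)" (is "_ = ?R")
proof
  show "?R \<subseteq> (\<lambda>y. h \<otimes> y \<otimes> inv h) ` conj_refined P x"
  proof
    fix y assume y: "y \<in> ?R"
    then have yc: "y \<in> carrier G" by (simp add: conj_refined_def)
    have unconj: "inv h \<otimes> (h \<otimes> x \<otimes> inv h) \<otimes> inv (inv h) = x"
      using conj_conj[of "inv h" h x] h x by simp
    have conj: "h \<otimes> (inv h \<otimes> y \<otimes> inv (inv h)) \<otimes> inv h = y"
      using conj_conj[of h "inv h" y] h yc by simp
    have "inv h \<otimes> y \<otimes> inv (inv h) \<in> conj_refined P x"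
      using conj_refined_conj_subset[OF inv_closed[OF h] _ y] unconj h x by simp
    then show "y \<in> (\<lambda>y. h \<otimes> y \<otimes> inv h) ` conj_refined P x" using conj by (metis imageI)
  qed
qed (use conj_refined_conj_subset[OF h x] in blast)

lemma conj_refined_proper:
  assumes P: "nontrivial_group_partition G P" and x: "x \<in> carrier G" "x \<noteq> \<one>"
  shows "conj_refined P x \<noteq> carrier G"
proof
  assume all: "conj_refined P x = carrier G"
  obtain A where A: "A \<in> P" "x \<in> A" using partition_cover[OF P x] .
  have "carrier G \<subseteq> A \<union> {\<one>}"
  proof
    fix y assume y: "y \<in> carrier G"
    then have "y \<in> conj_refined P x" using all by simp
    moreover have "\<one> \<otimes> x \<otimes> inv \<one> \<in> A" using A x by simp
    ultimately have "\<one> \<otimes> y \<otimes> inv \<one> \<in> A \<union> {\<one>}" using A(1) unfolding conj_refined_def by blast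
    then show "y \<in> A \<union> {\<one>}" using y by simp
  qed
  then show False
    using partition_proper[OF P A(1)] subgroup.subset[OF partition_subgroup[OF P A(1)]] by blast
qed

lemma partitioned_gain_graph_three:
  assumes "finite (carrier G)" and P: "nontrivial_group_partition G P"
  shows "partitioned_gain_graph G 3 (conj_refined P ` (carrier G - {\<one>}))"
proof (intro partitioned_gain_graph.intro gain_graph.intro is_group gain_graph_axioms.intro assms(1)
    partitioned_gain_graph_axioms.intro)
  \<comment> \<open>The identity is left out because no part contains it, so that
    \<open>conj_refined P \<one>\<close> is the whole group.\<close>
  let ?H = "conj_refined P ` (carrier G - {\<one>})"
  show "subgroup A G" if "A \<in> ?H" for A using that subgroup_conj_refined[OF P] by blast
  show "A \<noteq> carrier G" if "A \<in> ?H" for A using that conj_refined_proper[OF P] by blast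
  show "\<exists>A\<in>?H. x \<in> A" if "x \<in> carrier G" for x
  proof (cases "x = \<one>")
    case True
    obtain A y where "A \<in> P" "y \<in> A" using partition_nonempty[OF P] by blast
    then have "conj_refined P y \<in> ?H" using partition_closed[OF P] by blast
    then show ?thesis using True subgroup.one_closed[OF subgroup_conj_refined[OF P]] by blast
  qed (use that conj_refined_refl in blast)
  show "A = B" if "A \<in> ?H" "B \<in> ?H" "x \<in> A" "x \<in> B" "x \<noteq> \<one>" for A B x
    using that conj_refined_eq[OF P] by blast
  show "(\<lambda>x. g \<otimes> x \<otimes> inv g) ` A \<in> ?H" if A: "A \<in> ?H" and g: "g \<in> carrier G" for A g
  proof -
    obtain x where x: "x \<in> carrier G" "x \<noteq> \<one>" "A = conj_refined P x" using A by blast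
    then have "g \<otimes> x \<otimes> inv g \<in> carrier G - {\<one>}" using g conj_eq_one_iff by simp
    then show ?thesis using conj_refined_conj[OF g x(1)] x(3) by blast
  qed
qed simp_all

end

text \<open>The family consists of the lines of the group as a vector space over the field with
  \<open>p\<close> elements. All of them have order \<open>p\<close>, so two lines with a common
  nontrivial element coincide, and \<open>p < card (carrier G)\<close> makes them proper;
  conjugation is trivial here.\<close>

lemma (in comm_group) partitioned_gain_graph_elementary:
  assumes fin: "finite (carrier G)" and p: "prime p"
    and exp: "\<And>x. x \<in> carrier G \<Longrightarrow> x [^] (p::nat) = \<one>" and card: "p < card (carrier G)" and n: "2 \<le> n"
  shows "partitioned_gain_graph G n ((\<lambda>a. generate G {a}) ` (carrier G - {\<one>}))"
proof (intro partitioned_gain_graph.intro gain_graph.intro is_group gain_graph_axioms.intro fin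
    partitioned_gain_graph_axioms.intro)
  let ?H = "(\<lambda>a. generate G {a}) ` (carrier G - {\<one>})"
  have sub: "subgroup (generate G {a}) G" if "a \<in> carrier G" for a
    using generate_is_subgroup that by simp
  have card_gen: "card (generate G {a}) = p" if a: "a \<in> carrier G" "a \<noteq> \<one>" for a
  proof -
    have "ord a dvd p" using pow_eq_id[OF a(1)] exp[OF a(1)] by blast
    moreover have "ord a \<noteq> 1" using pow_eq_id[OF a(1), of 1] a by auto
    ultimately have "ord a = p" using p prime_nat_iff by blast
    then show ?thesis using generate_pow_card[OF a(1)] by simp
  qed
  show subH: "subgroup A G" if "A \<in> ?H" for A using that sub by blast
  show "A \<noteq> carrier G" if "A \<in> ?H" for A
  proof -
    have "card A = p" using that card_gen by blast
    then show ?thesis using card by blast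
  qed
  show "\<exists>A\<in>?H. x \<in> A" if x: "x \<in> carrier G" for x
  proof (cases "x = \<one>")
    case True
    have "carrier G \<noteq> {\<one>}" using card prime_gt_0_nat[OF p] by auto
    then obtain a where a: "a \<in> carrier G" "a \<noteq> \<one>" by blast
    then show ?thesis using True subgroup.one_closed[OF sub] by blast
  next
    case False
    then show ?thesis using x generate.incl[of x "{x}" G] by blast
  qed
  show "A = B" if AB: "A \<in> ?H" "B \<in> ?H" and x: "x \<in> A" "x \<in> B" "x \<noteq> \<one>" for A B x
  proof -
    have "generate G {x} = C" if C: "C \<in> ?H" "x \<in> C" for C
    proof -
      obtain a where a: "a \<in> carrier G" "a \<noteq> \<one>" "C = generate G {a}" using C by blast
      have xc: "x \<in> carrier G" using subgroup.mem_carrier[OF sub[OF a(1)]] a C by blast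
      have "generate G {x} \<subseteq> C" using generate_subgroup_incl[of "{x}" C] subH C by blast
      moreover have "finite C" using subgroup.subset[OF subH[OF C(1)]] fin finite_subset by blast
      moreover have "card (generate G {x}) = card C" using card_gen[OF xc x(3)] card_gen[OF a(1,2)] a(3) by simp
      ultimately show ?thesis using card_subset_eq by blast
    qed
    then show ?thesis using AB x by blast
  qed
  have conj: "g \<otimes> x \<otimes> inv g = x" if "g \<in> carrier G" "x \<in> carrier G" for g x
    using that by (simp add: m_comm[of g x] m_assoc)
  show "(\<lambda>x. g \<otimes> x \<otimes> inv g) ` A \<in> ?H" if A: "A \<in> ?H" and g: "g \<in> carrier G" for A g
  proof -
    have "(\<lambda>x. g \<otimes> x \<otimes> inv g) ` A = (\<lambda>x. x) ` A"
      by (rule image_cong) (use conj[OF g] subgroup.mem_carrier[OF subH[OF A]] in auto)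
    then show ?thesis using A by simp
  qed
  show "n = 3 \<or> (\<forall>A\<in>?H. \<forall>g\<in>carrier G. \<forall>x\<in>A. g \<otimes> x \<otimes> inv g \<in> A)"
    using conj subgroup.mem_carrier[OF subH] by metis
qed (rule n)

section \<open>Commutativity and exponent of a sum of cyclic groups\<close>

lemma pow_sum_integer_mod_group:
  assumes "0 < p" "f \<in> carrier (sum_group {..<j::nat} (\<lambda>_. integer_mod_group p))"
  shows "f [^]\<^bsub>sum_group {..<j} (\<lambda>_. integer_mod_group p)\<^esub> (m::nat) = (\<lambda>i\<in>{..<j}. (int m * f i) mod int p)"
proof (induction m)
  case (Suc m)
  then show ?case by (auto simp: fun_eq_iff mod_simps algebra_simps)
qed simp

lemma comm_group_sum_integer_mod_group:
  "comm_group (sum_group {..<j::nat} (\<lambda>_. integer_mod_group p))"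
  by (rule group.group_comm_groupI) (auto simp: add.commute intro: restrict_ext)

lemma (in group) iso_sum_integer_mod_group:
  assumes p: "prime p" and iso: "G \<cong> sum_group {..<j::nat} (\<lambda>_. integer_mod_group p)" (is "_ \<cong> ?S")
  shows "comm_group G" "\<And>x. x \<in> carrier G \<Longrightarrow> x [^] (p::nat) = \<one>"
proof -
  have "?S \<cong> G" using iso_sym[OF iso] .
  then show "comm_group G" using comm_group.iso_imp_comm_group[OF comm_group_sum_integer_mod_group _ is_monoid] by blast
  obtain h where h: "h \<in> iso G ?S" using iso by (auto simp: is_iso_def)
  have "group ?S" by simp
  then interpret h: group_hom G ?S h
    using h by (simp add: group_hom_def group_hom_axioms_def iso_def is_group)
  fix x assume x: "x \<in> carrier G"
  have "h (x [^] p) = \<one>\<^bsub>?S\<^esub>"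
    using pow_sum_integer_mod_group[OF prime_gt_0_nat[OF p] h.hom_closed[OF x], of p] h.hom_nat_pow[OF x, of p]
    by (simp add: fun_eq_iff)
  moreover have "inj_on h (carrier G)" using h by (simp add: iso_def bij_betw_def)
  ultimately show "x [^] p = \<one>" using h.inj_on_one_iff x by blast
qed

theorem theorem1p6:
  fixes G :: "('a, 'b) monoid_scheme" and n :: nat
  assumes "group G" and "finite (carrier G)" and "carrier G \<noteq> {\<one>\<^bsub>G\<^esub>}"
    and "n \<ge> 3"
  shows "(\<exists>M \<in> gain_lifts n G.
            matroid_rank M \<ge> matroid_rank (gain_cycle_matroid n G) + 2) \<longleftrightarrow>
         (n = 3 \<and> (\<exists>P. nontrivial_group_partition G P)) \<or>
         (n \<ge> 4 \<and> (\<exists>(p::nat) (j::nat). prime p \<and> j \<ge> 2 \<and>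
            G \<cong> sum_group {..<j} (\<lambda>_. integer_mod_group p)))"
    (is "?lifts \<longleftrightarrow> ?three \<or> ?four")
proof
  interpret G: group G by fact
  assume ?lifts
  then obtain M where M: "M \<in> gain_lifts n G"
    "matroid_rank M \<ge> matroid_rank (gain_cycle_matroid n G) + 2" by blast
  interpret gain_graph_lift G n M
    by (intro gain_graph_lift.intro gain_graph.intro gain_graph_axioms.intro
        gain_graph_lift_axioms.intro assms M)
  have P: "nontrivial_group_partition G parts" by (rule partition_parts[OF assms(3)])
  show "?three \<or> ?four"
  proof (cases "n = 3")
    case False
    then have n: "4 \<le> n" using assms(4) by simp
    interpret comm_group G
      by (rule G.group_comm_groupI) (rule G.normal_partition_commute[OF P parts_conj[OF n]])
    obtain p :: nat where p: "prime p" "\<And>x. x \<in> carrier G \<Longrightarrow> x [^]\<^bsub>G\<^esub> p = \<one>\<^bsub>G\<^esub>"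
      using partition_exponent[OF assms(2) P] by blast
    obtain j :: nat where j: "G \<cong> sum_group {..<j} (\<lambda>_. integer_mod_group p)"
      using elementary_abelian_iso[OF assms(2) p] by blast
    have card: "card (carrier G) = p ^ j"
      using iso_same_card[OF j] card_sum_integer_mod_group[OF prime_gt_0_nat[OF p(1)]] by simp
    \<comment> \<open>\<open>j = 0\<close> would give the trivial group, and \<open>j = 1\<close> a
      group of prime order, which has no nontrivial partition.\<close>
    have "j \<noteq> 0"
    proof
      assume "j = 0"
      then obtain y where "carrier G = {y}" using card by (auto simp: card_1_singleton_iff)
      then show False using assms(3) G.one_closed by auto
    qed
    moreover have "j \<noteq> 1" using G.partition_order_not_prime[OF assms(2) P] card p(1) by auto
    ultimately have "2 \<le> j" by simp
    then show ?thesis using n p j by blast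
  qed (use P in blast)
next
  interpret G: group G by fact
  assume "?three \<or> ?four"
  then have "\<exists>H. partitioned_gain_graph G n H"
  proof
    assume ?three
    then show ?thesis using G.partitioned_gain_graph_three[OF assms(2)] by blast
  next
    assume ?four
    then obtain p j :: nat where pj: "prime p" "2 \<le> j" "G \<cong> sum_group {..<j} (\<lambda>_. integer_mod_group p)"
      by blast
    have "p ^ 1 < p ^ j" by (rule power_strict_increasing) (use pj prime_gt_1_nat in auto)
    then have "p < card (carrier G)"
      using iso_same_card[OF pj(3)] card_sum_integer_mod_group[OF prime_gt_0_nat[OF pj(1)]] by simp
    then show ?thesis
      using comm_group.partitioned_gain_graph_elementary[OF G.iso_sum_integer_mod_group(1)[OF pj(1,3)]
          assms(2) pj(1) G.iso_sum_integer_mod_group(2)[OF pj(1,3)]] assms(4)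
      by (metis Suc_leD numeral_2_eq_2 numeral_3_eq_3)
  qed
  then obtain H where "partitioned_gain_graph G n H" by blast
  then interpret partitioned_gain_graph G n H .
  show ?lifts using gain_lift_in_gain_lifts gain_lift_rank by blast
qed

end
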